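(* Let $F=F(x,y)$ be a Finsler metric on an open neighborhood $\mathcal{U}$ of the origin in $\mathbb{R}^n$. Then $F$ is projectively flat with flag curvature ${\bf K}=-1$ if and only if there exist a Minkowski norm $\psi=\psi(y)$ and a positively homogeneous function $\phi=\phi(y)$ of degree one on $\mathbb{R}^n$, $C^\infty$ on $\mathbb{R}^n\setminus\{0\}$, such that $$F(x,y)=\tfrac12\big\{\Phi_+-\Phi_-\big\},$$ where $$\Phi_{\pm}=(\phi\pm\psi)(y+x\Phi_{\pm}).$$ In this case, $\psi(y)=F(0,y)$ and $\phi(y)=P(0,y)=\dfrac{F_{x^k}y^k}{2F}\Big|_{x=0}$.
   Context: Summation over repeated indices is understood; subscripts $x^k,y^k$ denote partial derivatives; $\Phi_\pm=\Phi_\pm(x,y)$, and $y+x\Phi_\pm$ denotes the vector with components $y^k+x^k\Phi_\pm(x,y)$. The tangent bundle of an open set $\mathcal{U}\subset\mathbb{R}^n$ is identified with $\mathcal{U}\times\mathbb{R}^n$. A function $h$ of $y$ is positively homogeneous of degree one if $h(\lambda y)=\lambda h(y)$ for all $\lambda>0$. A Minkowski norm on $\mathbb{R}^n$ is a nonnegative function $\psi$, $C^\infty$ on $\mathbb{R}^n\setminus\{0\}$, with $\psi(y)=0$ iff $y=0$, positively homogeneous of degree one, and such that the matrix $[\frac12\psi^2]_{y^iy^j}(y)$ is positive definite for $y\neq0$. A Finsler metric on $\mathcal{U}$ is a function $F$ on $\mathcal{U}\times\mathbb{R}^n$, $C^\infty$ on $\mathcal{U}\times(\mathbb{R}^n\setminus\{0\})$,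 such that $F(x,\cdot)$ is a Minkowski norm for each $x$. With $g_{ij}=[\frac12F^2]_{y^iy^j}$ and $(g^{ij})=(g_{ij})^{-1}$, the geodesic coefficients are $G^i=\frac14 g^{il}\{[F^2]_{x^my^l}y^m-[F^2]_{x^l}\}$. $F$ is projectively flat on $\mathcal{U}$ if all its geodesics are straight lines, equivalently $G^i=P\,y^i$ with $P=F_{x^k}y^k/(2F)$ (the projective factor). For a tangent plane $\Pi=\mathrm{span}\{y,u\}$ the flag curvature is ${\bf K}(\Pi,y)=\dfrac{g_{im}R^i_{\ k}u^ku^m}{F^2g_{ij}u^iu^j-[g_{ij}y^iu^j]^2}$, where $R^i_{\ k}=2\frac{\partial G^i}{\partial x^k}-y^j\frac{\partial^2G^i}{\partial x^j\partial y^k}+2G^j\frac{\partial^2G^i}{\partial y^j\partial y^k}-\frac{\partial G^i}{\partial y^j}\frac{\partial G^j}{\partial y^k}$; for projectively flat $F$ one has ${\bf K}=(P^2-P_{x^m}y^m)/F^2$.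
   Formalization: The neighborhood U is assumed connected (on a component not containing the origin F is unrelated to F(0,y), so the "only if" part fails) and n ≥ 2 (for n = 1 there are no tangent planes); the functions Φ± are understood to be C^∞ for y ≠ 0. *)

theory Defs
  imports "HOL-Analysis.Analysis"
begin

text \<open>Differentiability classes on an open set \<open>S\<close>, through iterated directional derivatives;
  every \<open>at x\<close> is the full neighbourhood filter, so these notions are meant for open \<open>S\<close> only.\<close>

primrec C_k_on :: "nat \<Rightarrow> ('a::real_normed_vector \<Rightarrow> 'b::real_normed_vector) \<Rightarrow> 'a set \<Rightarrow> bool" where
  "C_k_on 0 f S \<longleftrightarrow> continuous_on S f"
| "C_k_on (Suc k) f S \<longleftrightarrow>
     (\<forall>x\<in>S. f differentiable (at x)) \<and> (\<forall>v. C_k_on k (\<lambda>x. frechet_derivative f (at x) v) S)"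

definition smooth_on :: "('a::real_normed_vector \<Rightarrow> 'b::real_normed_vector) \<Rightarrow> 'a set \<Rightarrow> bool" where
  "smooth_on f S \<longleftrightarrow> (\<forall>k. C_k_on k f S)"

text \<open>\<open>pd k h y\<close> is the partial derivative \<open>h\<^sub>k\<close> at \<open>y\<close>. For a function of \<open>(x, y)\<close>, a partial
  derivative in \<open>x\<close> or in \<open>y\<close> is obtained by abstracting over that variable. Iterated subscripts
  are read from left to right: in \<open>h\<close> with subscripts \<open>x\<^sup>m y\<^sup>l\<close> the derivative in \<open>x\<^sup>m\<close> is inner.\<close>

definition pd :: "'n::finite \<Rightarrow> (real^'n \<Rightarrow> real) \<Rightarrow> real^'n \<Rightarrow> real" where
  "pd k h y = frechet_derivative h (at y) (axis k 1)"

definition pos_homogeneous :: "(real^'n \<Rightarrow> real) \<Rightarrow> bool" where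
  "pos_homogeneous h \<longleftrightarrow> (\<forall>y. \<forall>c>0. h (c *\<^sub>R y) = c * h y)"

definition half_sq_hessian :: "(real^'n \<Rightarrow> real) \<Rightarrow> real^'n \<Rightarrow> real^'n^'n" where
  "half_sq_hessian \<psi> y = (\<chi> i j. pd j (pd i (\<lambda>z. 1/2 * (\<psi> z)\<^sup>2)) y)"

definition pos_definite :: "real^'n^'n \<Rightarrow> bool" where
  "pos_definite A \<longleftrightarrow> (\<forall>v. v \<noteq> 0 \<longrightarrow> 0 < v \<bullet> (A *v v))"

definition minkowski_norm :: "(real^'n \<Rightarrow> real) \<Rightarrow> bool" where
  "minkowski_norm \<psi> \<longleftrightarrow>
     (\<forall>y. 0 \<le> \<psi> y) \<and> smooth_on \<psi> (- {0}) \<and> (\<forall>y. \<psi> y = 0 \<longleftrightarrow> y = 0) \<and>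
     pos_homogeneous \<psi> \<and> (\<forall>y. y \<noteq> 0 \<longrightarrow> pos_definite (half_sq_hessian \<psi> y))"

text \<open>A function on the tangent bundle \<open>U \<times> \<real>\<^sup>n\<close> is represented as a curried function \<open>F x y\<close>;
  its values for \<open>x\<close> outside \<open>U\<close> are irrelevant.\<close>

definition finsler_metric :: "(real^'n) set \<Rightarrow> (real^'n \<Rightarrow> real^'n \<Rightarrow> real) \<Rightarrow> bool" where
  "finsler_metric U F \<longleftrightarrow>
     smooth_on (\<lambda>(x, y). F x y) (U \<times> (- {0})) \<and> (\<forall>x\<in>U. minkowski_norm (F x))"

definition fund_tensor :: "(real^'n \<Rightarrow> real^'n \<Rightarrow> real) \<Rightarrow> real^'n \<Rightarrow> real^'n \<Rightarrow> real^'n^'n" where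
  "fund_tensor F x y = half_sq_hessian (F x) y"

definition geod_coeff :: "(real^'n \<Rightarrow> real^'n \<Rightarrow> real) \<Rightarrow> real^'n \<Rightarrow> real^'n \<Rightarrow> real^'n" where
  "geod_coeff F x y = (\<chi> i. 1/4 * (\<Sum>l\<in>UNIV. matrix_inv (fund_tensor F x y) $ i $ l *
     ((\<Sum>m\<in>UNIV. pd l (\<lambda>v. pd m (\<lambda>z. (F z v)\<^sup>2) x) y * y $ m) - pd l (\<lambda>z. (F z y)\<^sup>2) x)))"

text \<open>Geodesics are the constant-speed ones, i.e. the regular curves with
  \<open>c'' + 2 G(c, c') = 0\<close>, where \<open>G\<close> are the geodesic coefficients.\<close>

definition geodesic ::
  "(real^'n) set \<Rightarrow> (real^'n \<Rightarrow> real^'n \<Rightarrow> real) \<Rightarrow> real set \<Rightarrow> (real \<Rightarrow> real^'n) \<Rightarrow> bool" where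
  "geodesic U F I c \<longleftrightarrow> open I \<and> is_interval I \<and> c ` I \<subseteq> U \<and>
     (\<exists>v. \<forall>t\<in>I. (c has_vector_derivative v t) (at t) \<and> v t \<noteq> 0 \<and>
        (v has_vector_derivative - 2 *\<^sub>R geod_coeff F (c t) (v t)) (at t))"

definition projectively_flat :: "(real^'n) set \<Rightarrow> (real^'n \<Rightarrow> real^'n \<Rightarrow> real) \<Rightarrow> bool" where
  "projectively_flat U F \<longleftrightarrow> (\<forall>I c. geodesic U F I c \<longrightarrow> collinear (c ` I))"

definition proj_factor :: "(real^'n \<Rightarrow> real^'n \<Rightarrow> real) \<Rightarrow> real^'n \<Rightarrow> real^'n \<Rightarrow> real" where
  "proj_factor F x y = (\<Sum>k\<in>UNIV. pd k (\<lambda>z. F z y) x * y $ k) / (2 * F x y)"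

definition riemann_curv :: "(real^'n \<Rightarrow> real^'n \<Rightarrow> real) \<Rightarrow> real^'n \<Rightarrow> real^'n \<Rightarrow> real^'n^'n" where
  "riemann_curv F x y = (let G = geod_coeff F in \<chi> i k.
       2 * pd k (\<lambda>z. G z y $ i) x
     - (\<Sum>j\<in>UNIV. y $ j * pd k (\<lambda>v. pd j (\<lambda>z. G z v $ i) x) y)
     + 2 * (\<Sum>j\<in>UNIV. G x y $ j * pd k (pd j (\<lambda>v. G x v $ i)) y)
     - (\<Sum>j\<in>UNIV. pd j (\<lambda>v. G x v $ i) y * pd k (\<lambda>v. G x v $ j) y))"

text \<open>The flag curvature of the flag with pole \<open>y\<close> and tangent plane \<open>span {y, u}\<close>.\<close>

definition flag_curvature ::
  "(real^'n \<Rightarrow> real^'n \<Rightarrow> real) \<Rightarrow> real^'n \<Rightarrow> real^'n \<Rightarrow> real^'n \<Rightarrow> real" where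
  "flag_curvature F x y u = (let g = fund_tensor F x y; R = riemann_curv F x y in
     (\<Sum>i\<in>UNIV. \<Sum>m\<in>UNIV. \<Sum>k\<in>UNIV. g $ i $ m * R $ i $ k * u $ k * u $ m) /
     ((F x y)\<^sup>2 * (\<Sum>i\<in>UNIV. \<Sum>j\<in>UNIV. g $ i $ j * u $ i * u $ j)
       - (\<Sum>i\<in>UNIV. \<Sum>j\<in>UNIV. g $ i $ j * y $ i * u $ j)\<^sup>2))"

definition has_flag_curvature ::
  "(real^'n) set \<Rightarrow> (real^'n \<Rightarrow> real^'n \<Rightarrow> real) \<Rightarrow> real \<Rightarrow> bool" where
  "has_flag_curvature U F \<kappa> \<longleftrightarrow>
     (\<forall>x\<in>U. \<forall>y u. dim (span {y, u}) = 2 \<longrightarrow> flag_curvature F x y u = \<kappa>)"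

text \<open>\<open>F\<close> is given by \<open>\<psi>\<close>, \<open>\<phi>\<close> through solutions \<open>\<Phi>\<^sub>+ = Pp\<close> and \<open>\<Phi>\<^sub>- = Pm\<close> of the implicit
  equations. Like every function on the tangent bundle here, the solutions are smooth off the zero
  section; their homogeneity in \<open>y\<close> is not assumed.\<close>

definition implicit_representation ::
  "(real^'n) set \<Rightarrow> (real^'n \<Rightarrow> real^'n \<Rightarrow> real) \<Rightarrow> (real^'n \<Rightarrow> real) \<Rightarrow> (real^'n \<Rightarrow> real) \<Rightarrow>
   (real^'n \<Rightarrow> real^'n \<Rightarrow> real) \<Rightarrow> (real^'n \<Rightarrow> real^'n \<Rightarrow> real) \<Rightarrow> bool" where
  "implicit_representation U F \<psi> \<phi> Pp Pm \<longleftrightarrow>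
     minkowski_norm \<psi> \<and> pos_homogeneous \<phi> \<and> smooth_on \<phi> (- {0}) \<and>
     smooth_on (\<lambda>(x, y). Pp x y) (U \<times> (- {0})) \<and> smooth_on (\<lambda>(x, y). Pm x y) (U \<times> (- {0})) \<and>
     (\<forall>x\<in>U. \<forall>y.
        F x y = 1/2 * (Pp x y - Pm x y) \<and>
        Pp x y = \<phi> (y + Pp x y *\<^sub>R x) + \<psi> (y + Pp x y *\<^sub>R x) \<and>
        Pm x y = \<phi> (y + Pm x y *\<^sub>R x) - \<psi> (y + Pm x y *\<^sub>R x))"

end

(* Projective flatness says G = P y, which by Euler's identities amounts to Hamel's equation
   F_x = (P F)_y. For such F the condition K = -1 becomes P_x = P P_y + F F_y, so that
   Phi = P + F and Phi = P - F both satisfy Phi_x = Phi Phi_y. A solution of this equation is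
   constant along the lines (x, y0 + c (x0 - x)) with c = Phi(x0, y0); evaluating at x = 0 gives
   Phi(x0, y0) = Phi(0, y0 + Phi(x0, y0) x0). Conversely, differentiating the implicit equations
   gives Phi_x = Phi Phi_y for both solutions, and their half sum is the projective factor once
   it is known to be homogeneous in y. That F has geodesics in every direction, needed for
   G = P y, is the Picard-Lindeloef theorem. *)

theory Submission
  imports Defs
begin

section \<open>Smooth functions\<close>

text \<open>Two obstacles shape the propagation arguments. First, \<open>U\<close> is open and
  connected but may be far from convex, so the segment from x0 to 0 can leave it. Since Phi_x = Phi
  Phi_y holds in every direction of x, the points (x, y0 + c (x0 - x)) with x in \<open>U\<close>
  form a whole sheet parametrised by x, and D(x) = Phi(x, y0 + c (x0 - x)) - c satisfies dD = a D
  with a continuous form a. The zero set of such a D is open and closed, which replaces following a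
  line. The same principle spreads over \<open>U\<close> the homogeneity that is known at x = 0.
  Second, everything is smooth only for y \<noteq> 0, and the sheet can run into y = 0. It does so
  over at most one x; deleting one point keeps an open connected set connected in dimension at least
  2, and homogeneity of Phi shows that this x is not 0. For the curvature, G = P y makes R^i_k a
  multiple of the identity plus a rank-one term tau_k y^i. The two are separated by varying the
  second vector u of the flag: a vector u with F_y(u) = 0 sees only the scalar.\<close>

lemma frechet_derivative_cong_open:
  assumes "open S" "x \<in> S" "\<And>z. z \<in> S \<Longrightarrow> f z = g z"
  shows "frechet_derivative f (at x) = frechet_derivative g (at x)"
proof -
  have "(f has_derivative D) (at x) \<longleftrightarrow> (g has_derivative D) (at x)" for D
    using has_derivative_transform_within_open[OF _ assms(1,2), of f _ UNIV g]
      has_derivative_transform_within_open[OF _ assms(1,2), of g _ UNIV f] assms(3) by auto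
  then show ?thesis
    by (simp add: frechet_derivative_def)
qed

lemma differentiable_cong_open:
  assumes "open S" "x \<in> S" "\<And>z. z \<in> S \<Longrightarrow> f z = g z"
  shows "f differentiable (at x) \<longleftrightarrow> g differentiable (at x)"
  unfolding differentiable_def
  using has_derivative_transform_within_open[OF _ assms(1,2), of f _ UNIV g]
    has_derivative_transform_within_open[OF _ assms(1,2), of g _ UNIV f] assms(3) by auto

lemma C_k_on_cong:
  assumes "open S" "\<And>z. z \<in> S \<Longrightarrow> f z = g z"
  shows "C_k_on k f S \<longleftrightarrow> C_k_on k g S"
  using assms(2)
proof (induction k arbitrary: f g)
  case 0
  then show ?case
    by (simp cong: continuous_on_cong)
next
  case (Suc k)
  have "C_k_on k (\<lambda>x. frechet_derivative f (at x) v) S \<longleftrightarrow>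
      C_k_on k (\<lambda>x. frechet_derivative g (at x) v) S" for v
    by (rule Suc.IH) (simp add: frechet_derivative_cong_open[OF assms(1) _ Suc.prems])
  moreover have "(\<forall>x\<in>S. f differentiable (at x)) \<longleftrightarrow> (\<forall>x\<in>S. g differentiable (at x))"
    using differentiable_cong_open[OF assms(1), of _ f g] Suc.prems by blast
  ultimately show ?case
    by simp
qed

text \<open>\<open>frechet_derivative\<close> is chosen by description, whereas products, inverses
  and compositions come with an explicit derivative. On an open set the two agree, so the recursion
  can be run on the explicit one.\<close>

lemma C_k_on_SucI:
  assumes "open S" "\<And>x. x \<in> S \<Longrightarrow> (f has_derivative f' x) (at x)"
    and "\<And>v. C_k_on k (\<lambda>x. f' x v) S"
  shows "C_k_on (Suc k) f S"
proof -
  have "C_k_on k (\<lambda>x. frechet_derivative f (at x) v) S" for v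
    using assms(3)[of v] C_k_on_cong[OF assms(1), of "\<lambda>x. f' x v" "\<lambda>x. frechet_derivative f (at x) v"]
      frechet_derivative_at[OF assms(2)] by simp
  then show ?thesis
    using assms(2) by (auto simp: differentiable_def)
qed

lemma C_k_on_SucD:
  assumes "C_k_on (Suc k) f S" "x \<in> S"
  shows "(f has_derivative frechet_derivative f (at x)) (at x)"
  using assms frechet_derivative_works by auto

text \<open>The derivative of a product or an inverse contains undifferentiated factors, which must
  be known to belong to the lower class.\<close>

lemma C_k_on_Suc_lower: "C_k_on (Suc k) f S \<Longrightarrow> C_k_on k f S"
proof (induction k arbitrary: f)
  case 0
  then show ?case
    by (simp add: continuous_at_imp_continuous_on differentiable_imp_continuous_within)
next
  case (Suc k)
  have "C_k_on k (\<lambda>x. frechet_derivative f (at x) v) S" for v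
    using Suc.IH Suc.prems by simp
  then show ?case
    using Suc.prems by simp
qed

lemma C_k_on_const: "open S \<Longrightarrow> C_k_on k (\<lambda>x. c) S"
proof (induction k arbitrary: c)
  case (Suc k)
  show ?case
    by (rule C_k_on_SucI[OF Suc.prems, of _ "\<lambda>x v. 0" k]) (simp_all add: Suc)
qed simp

lemma C_k_on_add:
  "open S \<Longrightarrow> C_k_on k f S \<Longrightarrow> C_k_on k g S \<Longrightarrow> C_k_on k (\<lambda>x. f x + g x) S"
proof (induction k arbitrary: f g)
  case (Suc k)
  show ?case
    using Suc.prems(2,3)
    by (intro C_k_on_SucI[OF Suc.prems(1)
          has_derivative_add[OF C_k_on_SucD[OF Suc.prems(2)] C_k_on_SucD[OF Suc.prems(3)]]]
        Suc.IH Suc.prems) auto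
qed (auto intro: continuous_intros)

lemma C_k_on_mult:
  fixes f g :: "'a::real_normed_vector \<Rightarrow> real"
  shows "open S \<Longrightarrow> C_k_on k f S \<Longrightarrow> C_k_on k g S \<Longrightarrow> C_k_on k (\<lambda>x. f x * g x) S"
proof (induction k arbitrary: f g)
  case (Suc k)
  show ?case
    using Suc.prems(2,3)
    by (intro C_k_on_SucI[OF Suc.prems(1)
          has_derivative_mult[OF C_k_on_SucD[OF Suc.prems(2)] C_k_on_SucD[OF Suc.prems(3)]]]
        C_k_on_add Suc.IH Suc.prems C_k_on_Suc_lower[OF Suc.prems(2)]
        C_k_on_Suc_lower[OF Suc.prems(3)]) auto
qed (auto intro: continuous_intros)

text \<open>The induction keeps \<open>f\<close> fixed: the derivative of 1/f is - (1/f) f' (1/f),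
  so the induction hypothesis is applied to the same function 1/f, one order lower.\<close>

lemma C_k_on_inverse:
  fixes f :: "'a::real_normed_vector \<Rightarrow> real"
  shows "open S \<Longrightarrow> C_k_on k f S \<Longrightarrow> (\<And>x. x \<in> S \<Longrightarrow> f x \<noteq> 0) \<Longrightarrow> C_k_on k (\<lambda>x. inverse (f x)) S"
proof (induction k)
  case (Suc k)
  have *: "((\<lambda>x. inverse (f x)) has_derivative
      (\<lambda>v. (- 1) * (inverse (f x) * frechet_derivative f (at x) v * inverse (f x)))) (at x)"
    if "x \<in> S" for x
    using Deriv.has_derivative_inverse[OF Suc.prems(3)[OF that] C_k_on_SucD[OF Suc.prems(2) that]]
    by simp
  have "C_k_on k (\<lambda>x. inverse (f x)) S"
    by (rule Suc.IH[OF Suc.prems(1) C_k_on_Suc_lower[OF Suc.prems(2)] Suc.prems(3)])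
  then show ?case
    using Suc.prems(2)
    by (intro C_k_on_SucI[OF Suc.prems(1) *] C_k_on_mult C_k_on_const Suc.prems) auto
qed (auto intro: continuous_intros)

lemma C_k_on_bounded_linear:
  "bounded_linear h \<Longrightarrow> open S \<Longrightarrow> C_k_on k f S \<Longrightarrow> C_k_on k (\<lambda>x. h (f x)) S"
proof (induction k arbitrary: f)
  case 0
  then show ?case
    by (simp add: bounded_linear.continuous_on)
next
  case (Suc k)
  show ?case
    using Suc.prems(3)
    by (intro C_k_on_SucI[OF Suc.prems(2)
          bounded_linear.has_derivative[OF Suc.prems(1) C_k_on_SucD[OF Suc.prems(3)]]]
        Suc.IH Suc.prems(1,2)) auto
qed

lemma C_k_on_ident: "open S \<Longrightarrow> C_k_on k (\<lambda>x. x) S"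
proof (cases k)
  case (Suc k)
  assume "open S"
  then show ?thesis
    unfolding Suc by (intro C_k_on_SucI[where f' = "\<lambda>x v. v"]) (auto intro: C_k_on_const)
qed simp

text \<open>The inner map has the constant derivative \<open>h\<close>, so each derivative is again
  a function composed with the same map, and only \<open>f\<close> varies in the induction.\<close>

lemma C_k_on_compose_affine:
  assumes "open S" "bounded_linear h" "\<And>x. x \<in> S \<Longrightarrow> a + h x \<in> T"
  shows "C_k_on k f T \<Longrightarrow> C_k_on k (\<lambda>x. f (a + h x)) S"
proof (induction k arbitrary: f)
  case 0
  have "continuous_on S (\<lambda>x. a + h x)"
    using linear_continuous_on[OF assms(2)] by (intro continuous_on_add continuous_on_const)
  moreover have "continuous_on T f"
    using 0 by simp
  ultimately have "continuous_on S (\<lambda>x. f (a + h x))"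
    using assms(3) continuous_on_compose2[of T f S "\<lambda>x. a + h x"] by blast
  then show ?case
    by simp
next
  case (Suc k)
  have d: "((\<lambda>x. a + h x) has_derivative h) (at x)" for x
    using has_derivative_add[OF has_derivative_const bounded_linear.has_derivative[OF assms(2) has_derivative_ident]]
    by simp
  show ?case
  proof (rule C_k_on_SucI[OF assms(1)])
    show "((\<lambda>x. f (a + h x)) has_derivative (\<lambda>v. frechet_derivative f (at (a + h x)) (h v))) (at x)"
      if "x \<in> S" for x
      by (rule has_derivative_compose[OF d C_k_on_SucD[OF Suc.prems assms(3)[OF that]]])
    show "C_k_on k (\<lambda>x. frechet_derivative f (at (a + h x)) (h v)) S" for v
      using Suc.IH[of "\<lambda>y. frechet_derivative f (at y) (h v)"] Suc.prems by simp
  qed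
qed

section \<open>Smooth functions: derivatives and closure rules\<close>

lemma smooth_on_differentiable:
  assumes "smooth_on f S" "x \<in> S"
  shows "f differentiable (at x)"
  using assms C_k_on.simps(2)[of 0 f S] unfolding smooth_on_def by blast

lemma smooth_on_has_derivative:
  "smooth_on f S \<Longrightarrow> x \<in> S \<Longrightarrow> (f has_derivative frechet_derivative f (at x)) (at x)"
  using smooth_on_differentiable frechet_derivative_works by blast

lemma smooth_on_continuous_on: "smooth_on f S \<Longrightarrow> continuous_on S f"
  using C_k_on.simps(1)[of f S] unfolding smooth_on_def by blast

lemma smooth_on_frechet_derivative:
  "smooth_on f S \<Longrightarrow> smooth_on (\<lambda>x. frechet_derivative f (at x) v) S"
  using C_k_on.simps(2)[of _ f S] unfolding smooth_on_def by blast

lemma smooth_on_cong: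
  assumes "open S" "\<And>z. z \<in> S \<Longrightarrow> f z = g z"
  shows "smooth_on f S \<longleftrightarrow> smooth_on g S"
  unfolding smooth_on_def using C_k_on_cong[OF assms(1), of f g] assms(2) by blast

lemma smooth_on_transform:
  assumes "open S" "smooth_on g S" "\<And>z. z \<in> S \<Longrightarrow> f z = g z"
  shows "smooth_on f S"
  using smooth_on_cong[OF assms(1), of f g] assms(2,3) by simp

named_theorems smooth_intros

lemma smooth_on_const [smooth_intros]: "open S \<Longrightarrow> smooth_on (\<lambda>x. c) S"
  by (simp add: smooth_on_def C_k_on_const)

lemma smooth_on_ident [smooth_intros]: "open S \<Longrightarrow> smooth_on (\<lambda>x. x) S"
  by (simp add: smooth_on_def C_k_on_ident)

lemma smooth_on_add [smooth_intros]:
  "open S \<Longrightarrow> smooth_on f S \<Longrightarrow> smooth_on g S \<Longrightarrow> smooth_on (\<lambda>x. f x + g x) S"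
  by (simp add: smooth_on_def C_k_on_add)

lemma smooth_on_mult [smooth_intros]:
  fixes f g :: "'a::real_normed_vector \<Rightarrow> real"
  shows "open S \<Longrightarrow> smooth_on f S \<Longrightarrow> smooth_on g S \<Longrightarrow> smooth_on (\<lambda>x. f x * g x) S"
  by (simp add: smooth_on_def C_k_on_mult)

lemma smooth_on_inverse [smooth_intros]:
  fixes f :: "'a::real_normed_vector \<Rightarrow> real"
  shows "open S \<Longrightarrow> smooth_on f S \<Longrightarrow> (\<And>x. x \<in> S \<Longrightarrow> f x \<noteq> 0) \<Longrightarrow> smooth_on (\<lambda>x. inverse (f x)) S"
  by (simp add: smooth_on_def C_k_on_inverse)

lemma smooth_on_divide [smooth_intros]:
  fixes f g :: "'a::real_normed_vector \<Rightarrow> real"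
  shows "open S \<Longrightarrow> smooth_on f S \<Longrightarrow> smooth_on g S \<Longrightarrow> (\<And>x. x \<in> S \<Longrightarrow> g x \<noteq> 0) \<Longrightarrow>
    smooth_on (\<lambda>x. f x / g x) S"
  unfolding divide_inverse by (intro smooth_on_mult smooth_on_inverse)

lemma smooth_on_bounded_linear:
  "bounded_linear h \<Longrightarrow> open S \<Longrightarrow> smooth_on f S \<Longrightarrow> smooth_on (\<lambda>x. h (f x)) S"
  by (simp add: smooth_on_def C_k_on_bounded_linear)

lemma smooth_on_minus [smooth_intros]: "open S \<Longrightarrow> smooth_on f S \<Longrightarrow> smooth_on (\<lambda>x. - f x) S"
  by (rule smooth_on_bounded_linear[OF bounded_linear_minus[OF bounded_linear_ident]])

lemma smooth_on_diff [smooth_intros]: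
  "open S \<Longrightarrow> smooth_on f S \<Longrightarrow> smooth_on g S \<Longrightarrow> smooth_on (\<lambda>x. f x - g x) S"
  using smooth_on_add[of S f "\<lambda>x. - g x"] smooth_on_minus by auto

lemma smooth_on_compose_affine:
  assumes "open S" "bounded_linear h" "\<And>x. x \<in> S \<Longrightarrow> a + h x \<in> T" "smooth_on f T"
  shows "smooth_on (\<lambda>x. f (a + h x)) S"
  using C_k_on_compose_affine[OF assms(1-3), of _ f] assms(4) by (simp add: smooth_on_def)

lemma smooth_on_sum [smooth_intros]:
  "open S \<Longrightarrow> (\<And>i. i \<in> I \<Longrightarrow> smooth_on (f i) S) \<Longrightarrow> smooth_on (\<lambda>x. \<Sum>i\<in>I. f i x) S"
  by (induction I rule: infinite_finite_induct) (auto intro: smooth_intros)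

lemma smooth_on_prod [smooth_intros]:
  fixes f :: "'i \<Rightarrow> 'a::real_normed_vector \<Rightarrow> real"
  shows "open S \<Longrightarrow> (\<And>i. i \<in> I \<Longrightarrow> smooth_on (f i) S) \<Longrightarrow> smooth_on (\<lambda>x. \<Prod>i\<in>I. f i x) S"
  by (induction I rule: infinite_finite_induct) (auto intro: smooth_intros)

section \<open>Determinants and inverses of smooth matrix functions\<close>

lemma smooth_on_det [smooth_intros]:
  fixes A :: "'a::real_normed_vector \<Rightarrow> real^'n^'n"
  assumes "open S" "\<And>i j. smooth_on (\<lambda>x. A x $ i $ j) S"
  shows "smooth_on (\<lambda>x. det (A x)) S"
  unfolding det_def by (intro smooth_intros assms)

lemma matrix_mul_matrix_inv:
  fixes A :: "real^'n^'n"
  assumes "det A \<noteq> 0"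
  shows "A ** matrix_inv A = mat 1"
proof -
  have "invertible A"
    using assms by (simp add: invertible_det_nz)
  then show ?thesis
    using someI_ex[of "\<lambda>A'. A ** A' = mat 1 \<and> A' ** A = mat 1"]
    unfolding invertible_def matrix_inv_def by blast
qed

text \<open>Cramer's rule for column \<open>l\<close> of the inverse, which solves A z = e_l. The
  entries become quotients of polynomials in the entries of \<open>A\<close>, and smoothness can be
  read off.\<close>

lemma matrix_inv_entry:
  fixes A :: "real^'n^'n"
  assumes "det A \<noteq> 0"
  shows "matrix_inv A $ i $ l = det (\<chi> k j. if j = i then axis l 1 $ k else A $ k $ j) / det A"
proof -
  have "A *v (matrix_inv A *v axis l 1) = axis l 1"
    by (simp add: assms matrix_mul_matrix_inv matrix_vector_mul_assoc)
  then have "matrix_inv A *v axis l 1 = (\<chi> i. det (\<chi> k j. if j = i then axis l 1 $ k else A $ k $ j) / det A)"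
    using cramer[OF assms] by blast
  then have "(matrix_inv A *v axis l 1) $ i = det (\<chi> k j. if j = i then axis l 1 $ k else A $ k $ j) / det A"
    by simp
  then show ?thesis
    by (simp add: matrix_vector_mult_basis column_def)
qed

lemma smooth_on_matrix_inv [smooth_intros]:
  fixes A :: "'a::real_normed_vector \<Rightarrow> real^'n^'n"
  assumes S: "open S" and "\<And>i j. smooth_on (\<lambda>x. A x $ i $ j) S" "\<And>x. x \<in> S \<Longrightarrow> det (A x) \<noteq> 0"
  shows "smooth_on (\<lambda>x. matrix_inv (A x) $ i $ l) S"
proof -
  have "smooth_on (\<lambda>x. (\<chi> k j. if j = i then axis l 1 $ k else A x $ k $ j) $ k $ j) S" for k j
    by (cases "j = i") (auto intro!: assms smooth_on_const)
  then have "smooth_on (\<lambda>x. det (\<chi> k j. if j = i then axis l 1 $ k else A x $ k $ j) / det (A x)) S"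
    by (intro smooth_intros assms)
  then show ?thesis
    by (rule smooth_on_transform[OF S]) (simp add: matrix_inv_entry assms(3))
qed

lemma smooth_on_vec:
  fixes f :: "'a::real_normed_vector \<Rightarrow> real^'n"
  assumes S: "open S" and "\<And>i. smooth_on (\<lambda>x. f x $ i) S"
  shows "smooth_on f S"
proof -
  have "smooth_on (\<lambda>x. \<Sum>i\<in>UNIV. (f x $ i) *\<^sub>R axis i (1::real)) S"
    by (intro smooth_on_sum S smooth_on_bounded_linear[OF bounded_linear_scaleR_left] assms)
  moreover have "(\<Sum>i\<in>UNIV. (f x $ i) *\<^sub>R axis i (1::real)) = f x" for x
    using basis_expansion[of "f x"] by (simp add: scalar_mult_eq_scaleR)
  ultimately show ?thesis
    by simp
qed

text \<open>On a compact ball the derivatives along the basis vectors are bounded. Their bounds add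
  up to a bound of the operator norm, and the mean value inequality applies because the ball is
  convex.\<close>

lemma smooth_on_local_Lipschitz:
  fixes f :: "'a::euclidean_space \<Rightarrow> 'b::real_normed_vector"
  assumes "open S" "smooth_on f S" "p \<in> S"
  obtains r K where "0 < r" "cball p r \<subseteq> S" "0 \<le> K"
    "\<And>x z. x \<in> cball p r \<Longrightarrow> z \<in> cball p r \<Longrightarrow> norm (f x - f z) \<le> K * norm (x - z)"
proof -
  obtain r where r: "0 < r" "cball p r \<subseteq> S"
    using assms open_contains_cball by blast
  have "\<exists>M. \<forall>x\<in>cball p r. norm (frechet_derivative f (at x) b) \<le> M" for b
  proof -
    have "continuous_on (cball p r) (\<lambda>x. frechet_derivative f (at x) b)"
      using smooth_on_continuous_on[OF smooth_on_frechet_derivative[OF assms(2)]] r(2)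
      by (rule continuous_on_subset)
    then have "bounded ((\<lambda>x. frechet_derivative f (at x) b) ` cball p r)"
      by (intro compact_imp_bounded compact_continuous_image) auto
    then show ?thesis
      by (auto simp: bounded_iff)
  qed
  then obtain M where M: "\<And>b x. x \<in> cball p r \<Longrightarrow> norm (frechet_derivative f (at x) b) \<le> M b"
    by metis
  define K where "K = (\<Sum>b\<in>Basis. \<bar>M b\<bar>)"
  have on: "onorm (frechet_derivative f (at x)) \<le> K" if x: "x \<in> cball p r" for x
  proof (rule onorm_bound)
    show "0 \<le> K"
      by (simp add: K_def sum_nonneg)
    fix v
    have "linear (frechet_derivative f (at x))"
      using smooth_on_has_derivative[OF assms(2)] x r(2) has_derivative_linear by blast
    then have "frechet_derivative f (at x) (\<Sum>b\<in>Basis. (v \<bullet> b) *\<^sub>R b) =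
        (\<Sum>b\<in>Basis. (v \<bullet> b) *\<^sub>R frechet_derivative f (at x) b)"
      by (simp add: linear_sum linear_scale)
    then have "frechet_derivative f (at x) v = (\<Sum>b\<in>Basis. (v \<bullet> b) *\<^sub>R frechet_derivative f (at x) b)"
      by (simp only: euclidean_representation)
    also have "norm \<dots> \<le> (\<Sum>b\<in>Basis. norm v * \<bar>M b\<bar>)"
    proof (rule sum_norm_le)
      fix b :: 'a assume "b \<in> Basis"
      then have "\<bar>v \<bullet> b\<bar> \<le> norm v"
        by (rule Basis_le_norm)
      moreover have "norm (frechet_derivative f (at x) b) \<le> \<bar>M b\<bar>"
        using M[OF x, of b] by linarith
      ultimately show "norm ((v \<bullet> b) *\<^sub>R frechet_derivative f (at x) b) \<le> norm v * \<bar>M b\<bar>"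
        by (simp add: mult_mono)
    qed
    finally show "norm (frechet_derivative f (at x) v) \<le> K * norm v"
      by (simp add: K_def sum_distrib_left mult.commute)
  qed
  have "norm (f x - f z) \<le> K * norm (x - z)" if "x \<in> cball p r" "z \<in> cball p r" for x z
    by (rule differentiable_bound[OF convex_cball _ on that])
      (use smooth_on_has_derivative[OF assms(2)] r(2) has_derivative_at_withinI in blast)
  moreover have "0 \<le> K"
    by (simp add: K_def sum_nonneg)
  ultimately show ?thesis
    using r that by blast
qed

section \<open>Ordinary differential equations\<close>

text \<open>Integrating factor: h exp(- A) has derivative zero when A is an antiderivative of
  \<open>\<alpha>\<close>.\<close>

lemma linear_ode_zero:
  fixes h \<alpha> :: "real \<Rightarrow> real"
  assumes h: "\<And>t. t \<in> {a..b} \<Longrightarrow> (h has_real_derivative \<alpha> t * h t) (at t within {a..b})"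
    and \<alpha>: "continuous_on {a..b} \<alpha>" and "t0 \<in> {a..b}" "h t0 = 0" "t \<in> {a..b}"
  shows "h t = 0"
proof -
  obtain A where A: "\<And>t. t \<in> {a..b} \<Longrightarrow> (A has_vector_derivative \<alpha> t) (at t within {a..b})"
    using antiderivative_continuous[OF \<alpha>] by blast
  define k where "k = (\<lambda>t. h t * exp (- A t))"
  have "(k has_field_derivative 0) (at t within {a..b})" if "t \<in> {a..b}" for t
    unfolding k_def
    by (rule derivative_eq_intros h[OF that] A[OF that, folded has_real_derivative_iff_has_vector_derivative] refl)+
      simp
  then obtain c where "\<And>t. t \<in> {a..b} \<Longrightarrow> k t = c"
    using has_field_derivative_zero_constant[of "{a..b}" k] by auto
  then have "k t = k t0"
    using assms by simp
  then show ?thesis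
    using assms by (simp add: k_def)
qed

text \<open>The zero set is closed by continuity. It is open because on a segment issuing from a
  zero, inside a ball in \<open>V\<close>, the equation becomes a linear ordinary one with initial
  value 0.\<close>

lemma linear_pde_zero:
  fixes D :: "'a::real_normed_vector \<Rightarrow> real"
  assumes V: "open V" "connected V"
    and D: "\<And>x. x \<in> V \<Longrightarrow> (D has_derivative (\<lambda>u. A x u * D x)) (at x)"
    and A: "\<And>u. continuous_on V (\<lambda>x. A x u)"
    and x0: "x0 \<in> V" "D x0 = 0" and x: "x \<in> V"
  shows "D x = 0"
proof -
  define Z where "Z = {x \<in> V. D x = 0}"
  have "continuous_on V D"
    using D by (meson continuous_at_imp_continuous_on has_derivative_continuous)
  then have "closedin (top_of_set V) Z"
    using continuous_closedin_preimage_constant[of V D 0] by (simp add: Z_def)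
  moreover have "openin (top_of_set V) Z"
  proof -
    have "\<exists>e>0. ball z e \<subseteq> Z" if z: "z \<in> Z" for z
    proof -
      have "z \<in> V" "D z = 0"
        using z by (auto simp: Z_def)
      obtain e where e: "0 < e" "ball z e \<subseteq> V"
        using \<open>z \<in> V\<close> V(1) open_contains_ball by blast
      have "D w = 0" if w: "w \<in> ball z e" for w
      proof -
        define \<gamma> where "\<gamma> t = z + t *\<^sub>R (w - z)" for t :: real
        have \<gamma>V: "\<gamma> t \<in> V" if "t \<in> {0..1}" for t
        proof -
          have "norm (\<gamma> t - z) \<le> norm (w - z)"
            using that by (simp add: \<gamma>_def mult_left_le_one_le)
          then show ?thesis
            using w e(2) by (auto simp: dist_norm norm_minus_commute subset_iff)
        qed
        have \<gamma>': "(\<gamma> has_vector_derivative (w - z)) (at t within {0..1})" for t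
          unfolding \<gamma>_def by (auto intro!: derivative_eq_intros)
        have "D (\<gamma> 1) = 0"
        proof (rule linear_ode_zero[of 0 1 "\<lambda>t. D (\<gamma> t)" "\<lambda>t. A (\<gamma> t) (w - z)" 0 1])
          show "((\<lambda>t. D (\<gamma> t)) has_real_derivative A (\<gamma> t) (w - z) * D (\<gamma> t)) (at t within {0..1})"
            if "t \<in> {0..1}" for t
          proof -
            have "((\<lambda>t. D (\<gamma> t)) has_derivative (\<lambda>s. A (\<gamma> t) (s *\<^sub>R (w - z)) * D (\<gamma> t))) (at t within {0..1})"
              using has_derivative_compose[OF \<gamma>'[unfolded has_vector_derivative_def] D[OF \<gamma>V[OF that]]]
              by simp
            \<comment> \<open>Scaling is taken from the whole product, which is the derivative of
              \<open>D\<close> and hence linear; \<open>A\<close> itself is arbitrary wherever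
              \<open>D\<close> vanishes.\<close>
            moreover have "A (\<gamma> t) (s *\<^sub>R (w - z)) * D (\<gamma> t) = s * (A (\<gamma> t) (w - z) * D (\<gamma> t))" for s
              using linear_scale[OF has_derivative_linear[OF D[OF \<gamma>V[OF that]]], of s "w - z"] by simp
            ultimately have "((\<lambda>t. D (\<gamma> t)) has_derivative (\<lambda>s. s * (A (\<gamma> t) (w - z) * D (\<gamma> t)))) (at t within {0..1})"
              by (simp only:)
            then show ?thesis
              by (simp only: has_field_derivative_def mult_commute_abs)
          qed
          have "continuous_on {0..1} \<gamma>"
            unfolding \<gamma>_def by (intro continuous_intros)
          then show "continuous_on {0..1} (\<lambda>t. A (\<gamma> t) (w - z))"
            using \<gamma>V by (intro continuous_on_compose2[OF A, of "{0..1}" \<gamma>]) auto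
        qed (simp_all add: \<gamma>_def \<open>D z = 0\<close>)
        then show ?thesis
          by (simp add: \<gamma>_def)
      qed
      then show ?thesis
        using e by (auto simp: Z_def)
    qed
    then have "open Z"
      by (simp add: open_contains_ball)
    then show ?thesis
      by (simp add: Z_def open_subset)
  qed
  ultimately have "Z = {} \<or> Z = V"
    using V(2) connected_clopen by blast
  then show ?thesis
    using x0 x by (auto simp: Z_def)
qed

text \<open>The solution is the fixed point of the Picard operator on bounded continuous functions on
  the whole line, so functions on \<open>{0..2\<delta>}\<close> are extended by their boundary values. The initial
  value is prescribed at the midpoint \<open>\<delta>\<close>, and the integral is based at \<open>0\<close>.\<close>

lemma picard_lindeloef:
  fixes f :: "'a::euclidean_space \<Rightarrow> 'a"
  assumes r: "0 < r" and K: "0 \<le> K"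
    and L: "\<And>x z. x \<in> cball p r \<Longrightarrow> z \<in> cball p r \<Longrightarrow> norm (f x - f z) \<le> K * norm (x - z)"
  obtains \<delta> c where "0 < \<delta>" "c \<delta> = p" "\<And>t. t \<in> {0..2 * \<delta>} \<Longrightarrow> c t \<in> cball p r"
    "\<And>t. t \<in> {0..2 * \<delta>} \<Longrightarrow> (c has_vector_derivative f (c t)) (at t within {0..2 * \<delta>})"
proof -
  define M where "M = norm (f p) + K * r + 1"
  have M: "norm (f x) \<le> M" if "x \<in> cball p r" for x
  proof -
    have "norm (f x - f p) \<le> K * norm (x - p)"
      using L[OF that] r by simp
    also have "\<dots> \<le> K * r"
      using that K by (intro mult_left_mono) (auto simp: dist_norm norm_minus_commute)
    finally show ?thesis
      using norm_triangle_ineq2[of "f x" "f p"] by (simp add: M_def)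
  qed
  have M0: "0 < M"
    using K r by (simp add: M_def add_nonneg_pos)
  \<comment> \<open>The operator combines integrals over [0, cl t] and [0, \<delta>], of total
    length at most 3 \<delta>. The first bound keeps its values within \<open>r\<close> of
    \<open>p\<close>, the second makes its Lipschitz constant K 3 \<delta> at most 1/2. The summand
    1 in \<open>M\<close> and in K + 1 keeps the denominators positive.\<close>
  define \<delta> where "\<delta> = min (r / (3 * M)) (1 / (6 * (K + 1)))"
  have \<delta>0: "0 < \<delta>"
    using r M0 K by (simp add: \<delta>_def)
  have "\<delta> \<le> r / (3 * M)" "\<delta> \<le> 1 / (6 * (K + 1))"
    by (simp_all add: \<delta>_def)
  then have \<delta>M: "M * (3 * \<delta>) \<le> r" and "6 * \<delta> * (K + 1) \<le> 1"
    using M0 K by (simp_all add: field_simps)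
  then have \<delta>K: "K * (3 * \<delta>) \<le> 1 / 2"
    using \<delta>0 by (simp add: algebra_simps)
  have contf: "continuous_on (cball p r) f"
    using L K by (intro lipschitz_on_continuous_on[of K] lipschitz_onI) (auto simp: dist_norm)
  define cl where "cl t = max 0 (min t (2 * \<delta>))" for t :: real
  have cl: "cl t \<in> {0..2 * \<delta>}" for t
    using \<delta>0 by (auto simp: cl_def)
  have cl_id: "cl t = t" if "t \<in> {0..2 * \<delta>}" for t
    using that by (auto simp: cl_def)
  define B where "B = (PiC UNIV (\<lambda>_. cball p r) :: (real \<Rightarrow>\<^sub>C 'a) set)"
  have B: "u \<in> B \<longleftrightarrow> (\<forall>t. apply_bcontfun u t \<in> cball p r)" for u
    by (auto simp: B_def mem_PiC_iff)
  define H where "H u t = integral {0..t} (\<lambda>s. f (apply_bcontfun u s))" for u :: "real \<Rightarrow>\<^sub>C 'a" and t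
  have contfu: "continuous_on X (\<lambda>s. f (apply_bcontfun u s))" if "u \<in> B" for u and X
    by (rule continuous_on_compose2[OF contf]) (use that B in \<open>auto intro: continuous_on_subset\<close>)
  define T' where "T' u t = p + H u (cl t) - H u \<delta>" for u t
  have H_bound: "norm (H u t) \<le> M * t" if "u \<in> B" "0 \<le> t" for u t
    unfolding H_def using integral_bound[OF that(2) contfu[OF that(1)], of M] M that B by auto
  have T'_B: "T' u t \<in> cball p r" if "u \<in> B" for u t
  proof -
    have "norm (T' u t - p) \<le> norm (H u (cl t)) + norm (H u \<delta>)"
      using norm_triangle_ineq4[of "H u (cl t)" "H u \<delta>"] by (simp add: T'_def)
    also have "\<dots> \<le> M * cl t + M * \<delta>"
      using H_bound[OF that] cl[of t] \<delta>0 by (intro add_mono) auto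
    also have "\<dots> \<le> M * (2 * \<delta>) + M * \<delta>"
      using cl[of t] M0 by (intro add_mono mult_left_mono) auto
    also have "\<dots> \<le> r"
      using \<delta>M by (simp add: algebra_simps)
    finally show ?thesis
      by (simp add: dist_norm norm_minus_commute)
  qed
  have T'_cont: "continuous_on UNIV (T' u)" if "u \<in> B" for u
  proof -
    have "continuous_on {0..2 * \<delta>} (H u)"
      unfolding H_def
      by (intro indefinite_integral_continuous_1 integrable_continuous_real contfu that)
    moreover have "continuous_on UNIV cl"
      unfolding cl_def by (intro continuous_intros)
    ultimately have "continuous_on UNIV (\<lambda>t. H u (cl t))"
      using cl continuous_on_compose2[of "{0..2 * \<delta>}" "H u" UNIV cl] by blast
    then show ?thesis
      unfolding T'_def by (intro continuous_intros)
  qed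
  define T where "T u = Bcontfun (T' u)" for u
  have T: "apply_bcontfun (T u) = T' u" if "u \<in> B" for u
  proof -
    have "T' u \<in> bcontfun"
      using T'_cont[OF that] T'_B[OF that]
      by (auto simp: bcontfun_def intro!: bounded_subset[OF bounded_cball])
    then show ?thesis
      by (simp add: T_def Bcontfun_inverse)
  qed
  have T_lip: "dist (T u) (T v) \<le> 1 / 2 * dist u v" if "u \<in> B" "v \<in> B" for u v
  proof (rule dist_bound)
    fix t
    have HH: "norm (H u s - H v s) \<le> K * dist u v * s" if s: "0 \<le> s" for s
    proof -
      have "H u s - H v s = integral {0..s} (\<lambda>s. f (apply_bcontfun u s) - f (apply_bcontfun v s))"
        unfolding H_def using that \<open>u \<in> B\<close> \<open>v \<in> B\<close>
        by (intro integral_diff[symmetric] integrable_continuous_real contfu)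
      also have "norm \<dots> \<le> K * dist u v * (s - 0)"
      proof (rule integral_bound[OF s])
        show "continuous_on {0..s} (\<lambda>s. f (apply_bcontfun u s) - f (apply_bcontfun v s))"
          using \<open>u \<in> B\<close> \<open>v \<in> B\<close> by (intro continuous_intros contfu)
        fix s
        have "norm (f (apply_bcontfun u s) - f (apply_bcontfun v s)) \<le> K * norm (apply_bcontfun u s - apply_bcontfun v s)"
          using \<open>u \<in> B\<close> \<open>v \<in> B\<close> B by (intro L) auto
        also have "\<dots> \<le> K * dist u v"
          using dist_bounded[of u s v] K by (intro mult_left_mono) (auto simp: dist_norm)
        finally show "norm (f (apply_bcontfun u s) - f (apply_bcontfun v s)) \<le> K * dist u v" .
      qed
      finally show ?thesis
        by simp
    qed
    have "dist (T u t) (T v t) = norm ((H u (cl t) - H v (cl t)) - (H u \<delta> - H v \<delta>))"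
      using T that by (simp add: T'_def dist_norm algebra_simps)
    also have "\<dots> \<le> norm (H u (cl t) - H v (cl t)) + norm (H u \<delta> - H v \<delta>)"
      by (rule norm_triangle_ineq4)
    also have "\<dots> \<le> K * dist u v * cl t + K * dist u v * \<delta>"
      using HH cl[of t] \<delta>0 by (intro add_mono) auto
    also have "\<dots> \<le> K * dist u v * (2 * \<delta>) + K * dist u v * \<delta>"
      using cl[of t] K by (intro add_mono mult_left_mono) auto
    also have "\<dots> = K * (3 * \<delta>) * dist u v"
      by (simp add: algebra_simps)
    also have "\<dots> \<le> 1 / 2 * dist u v"
      using \<delta>K by (intro mult_right_mono) auto
    finally show "dist (T u t) (T v t) \<le> 1 / 2 * dist u v" .
  qed
  have "\<exists>!u. u \<in> B \<and> T u = u"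
  proof (rule Banach_fix[of B "1/2"])
    show "complete B"
      unfolding B_def by (simp add: complete_eq_closed closed_PiC)
    have "const_bcontfun p \<in> B"
      using r by (simp add: B)
    then show "B \<noteq> {}"
      by blast
    show "T ` B \<subseteq> B"
      using T T'_B B by auto
  qed (use T_lip in auto)
  then obtain u where u: "u \<in> B" "T u = u"
    by blast
  have ut: "apply_bcontfun u t = p + H u (cl t) - H u \<delta>" for t
    using T[OF u(1)] u(2) by (simp add: T'_def)
  have "(apply_bcontfun u has_vector_derivative f (apply_bcontfun u t)) (at t within {0..2 * \<delta>})"
    if t: "t \<in> {0..2 * \<delta>}" for t
  proof (rule has_vector_derivative_transform[OF t])
    show "apply_bcontfun u s = p + H u s - H u \<delta>" if "s \<in> {0..2 * \<delta>}" for s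
      using ut[of s] cl_id[OF that] by simp
    have "(H u has_vector_derivative f (apply_bcontfun u t)) (at t within {0..2 * \<delta>})"
      unfolding H_def by (rule integral_has_vector_derivative[OF contfu[OF u(1)] t])
    then show "((\<lambda>s. p + H u s - H u \<delta>) has_vector_derivative f (apply_bcontfun u t)) (at t within {0..2 * \<delta>})"
      by (auto intro!: derivative_eq_intros)
  qed
  moreover have "apply_bcontfun u \<delta> = p"
    using ut[of \<delta>] cl_id[of \<delta>] \<delta>0 by simp
  ultimately show ?thesis
    using that[of \<delta> "apply_bcontfun u"] \<delta>0 u(1) B by blast
qed

section \<open>Partial derivatives on the slit tangent bundle\<close>

text \<open>A metric is treated as one function of the pair (x, y), so that mixed derivatives are
  iterated directional derivatives of a single function. Arbitrary directions keep most identities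
  free of index sums.\<close>

definition der :: "'a::real_normed_vector \<Rightarrow> ('a \<Rightarrow> real) \<Rightarrow> 'a \<Rightarrow> real" where
  "der v H p = frechet_derivative H (at p) v"

abbreviation dx :: "'a::real_normed_vector \<Rightarrow> ('a \<times> 'b::real_normed_vector \<Rightarrow> real) \<Rightarrow> 'a \<times> 'b \<Rightarrow> real" where
  "dx a \<equiv> der (a, 0)"

abbreviation dy :: "'b::real_normed_vector \<Rightarrow> ('a::real_normed_vector \<times> 'b \<Rightarrow> real) \<Rightarrow> 'a \<times> 'b \<Rightarrow> real" where
  "dy b \<equiv> der (0, b)"

lemma der_eqI: "(H has_derivative H') (at p) \<Longrightarrow> der v H p = H' v"
  unfolding der_def using frechet_derivative_at by metis

lemma has_derivative_der:
  "H differentiable (at p) \<Longrightarrow> (H has_derivative (\<lambda>v. der v H p)) (at p)"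
  by (simp add: der_def frechet_derivative_works[symmetric] eta_contract_eq)

lemma linear_der: "H differentiable (at p) \<Longrightarrow> linear (\<lambda>v. der v H p)"
  using has_derivative_der has_derivative_linear by blast

lemma der_pair: "H differentiable (at p) \<Longrightarrow> der (a, b) H p = dx a H p + dy b H p"
  using linear_add[OF linear_der, of H p "(a, 0)" "(0, b)"] by simp

lemma der_cong:
  assumes "open S" "p \<in> S" "\<And>z. z \<in> S \<Longrightarrow> H z = K z"
  shows "der v H p = der v K p"
  unfolding der_def using frechet_derivative_cong_open[OF assms] by simp

lemma smooth_on_der [smooth_intros]: "smooth_on H S \<Longrightarrow> smooth_on (der v H) S"
  using smooth_on_frechet_derivative[of H S v] by (simp add: der_def[abs_def])

lemma der_const [simp]: "der v (\<lambda>p. c) p = 0"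
  by (simp add: der_def)

lemma der_add:
  "H differentiable (at p) \<Longrightarrow> K differentiable (at p) \<Longrightarrow>
    der v (\<lambda>p. H p + K p) p = der v H p + der v K p"
  by (rule der_eqI[OF has_derivative_add[OF has_derivative_der has_derivative_der]])

lemma der_diff:
  "H differentiable (at p) \<Longrightarrow> K differentiable (at p) \<Longrightarrow>
    der v (\<lambda>p. H p - K p) p = der v H p - der v K p"
  by (rule der_eqI[OF has_derivative_diff[OF has_derivative_der has_derivative_der]])

lemma der_mult:
  "H differentiable (at p) \<Longrightarrow> K differentiable (at p) \<Longrightarrow>
    der v (\<lambda>p. H p * K p) p = H p * der v K p + der v H p * K p"
  by (rule der_eqI[OF has_derivative_mult[OF has_derivative_der has_derivative_der]])

lemma der_cmult:
  "H differentiable (at p) \<Longrightarrow> der v (\<lambda>p. c * H p) p = c * der v H p"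
  by (rule der_eqI[OF has_derivative_mult_right[OF has_derivative_der]])

lemma der_sum:
  "(\<And>i. i \<in> I \<Longrightarrow> H i differentiable (at p)) \<Longrightarrow>
    der v (\<lambda>p. \<Sum>i\<in>I. H i p) p = (\<Sum>i\<in>I. der v (H i) p)"
  by (rule der_eqI[OF has_derivative_sum[OF has_derivative_der]])

lemma der_snd_nth [simp]: "der v (\<lambda>p. snd p $ i) p = snd v $ i"
  by (rule der_eqI) (auto intro!: derivative_eq_intros bounded_linear.has_derivative[OF bounded_linear_vec_nth])

lemma smooth_on_snd_nth [smooth_intros]: "open S \<Longrightarrow> smooth_on (\<lambda>p. snd p $ i) S"
  by (intro smooth_on_bounded_linear[where h = "\<lambda>p. snd p $ i"] smooth_on_ident
      bounded_linear_compose[OF bounded_linear_vec_nth bounded_linear_snd])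

lemma vec_expansion: "(\<Sum>k\<in>UNIV. (a $ k) *\<^sub>R axis k 1) = (a :: real^'n)"
  using basis_expansion[of a] by (simp add: scalar_mult_eq_scaleR)

lemma linear_dx: "H differentiable (at p) \<Longrightarrow> linear (\<lambda>a. dx a H p)"
  using linear_compose[OF _ linear_der, of "\<lambda>a. (a, 0)"] by (simp add: o_def linear_iff)

lemma linear_dy: "H differentiable (at p) \<Longrightarrow> linear (\<lambda>b. dy b H p)"
  using linear_compose[OF _ linear_der, of "\<lambda>b. (0, b)"] by (simp add: o_def linear_iff)

lemma dx_expansion:
  fixes H :: "(real^'n) \<times> 'b::real_normed_vector \<Rightarrow> real"
  assumes "H differentiable (at p)"
  shows "dx a H p = (\<Sum>k\<in>UNIV. a $ k * dx (axis k 1) H p)"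
  using linear_sum[OF linear_dx[OF assms], of "\<lambda>k. (a $ k) *\<^sub>R axis k 1" UNIV]
    linear_scale[OF linear_dx[OF assms]]
  by (simp add: vec_expansion)

lemma dy_expansion:
  fixes H :: "'a::real_normed_vector \<times> (real^'n) \<Rightarrow> real"
  assumes "H differentiable (at p)"
  shows "dy b H p = (\<Sum>k\<in>UNIV. b $ k * dy (axis k 1) H p)"
  using linear_sum[OF linear_dy[OF assms], of "\<lambda>k. (b $ k) *\<^sub>R axis k 1" UNIV]
    linear_scale[OF linear_dy[OF assms]]
  by (simp add: vec_expansion)

lemma der_dx_expansion:
  fixes H :: "(real^'n) \<times> 'b::real_normed_vector \<Rightarrow> real"
  assumes "open S" "smooth_on H S" "p \<in> S"
  shows "der v (dx a H) p = (\<Sum>k\<in>UNIV. a $ k * der v (dx (axis k 1) H) p)"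
proof -
  have "der v (dx a H) p = der v (\<lambda>p. \<Sum>k\<in>UNIV. a $ k * dx (axis k 1) H p) p"
    by (rule der_cong[OF assms(1,3) dx_expansion[OF smooth_on_differentiable[OF assms(2)]]])
  also have "\<dots> = (\<Sum>k\<in>UNIV. der v (\<lambda>p. a $ k * dx (axis k 1) H p) p)"
    by (intro der_sum smooth_on_differentiable[OF _ assms(3)] smooth_intros assms)
  also have "\<dots> = (\<Sum>k\<in>UNIV. a $ k * der v (dx (axis k 1) H) p)"
    by (intro sum.cong refl der_cmult smooth_on_differentiable[OF _ assms(3)] smooth_intros assms)
  finally show ?thesis .
qed

lemma der_dy_expansion:
  fixes H :: "'a::real_normed_vector \<times> (real^'n) \<Rightarrow> real"
  assumes "open S" "smooth_on H S" "p \<in> S"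
  shows "der v (dy b H) p = (\<Sum>k\<in>UNIV. b $ k * der v (dy (axis k 1) H) p)"
proof -
  have "der v (dy b H) p = der v (\<lambda>p. \<Sum>k\<in>UNIV. b $ k * dy (axis k 1) H p) p"
    by (rule der_cong[OF assms(1,3) dy_expansion[OF smooth_on_differentiable[OF assms(2)]]])
  also have "\<dots> = (\<Sum>k\<in>UNIV. der v (\<lambda>p. b $ k * dy (axis k 1) H p) p)"
    by (intro der_sum smooth_on_differentiable[OF _ assms(3)] smooth_intros assms)
  also have "\<dots> = (\<Sum>k\<in>UNIV. b $ k * der v (dy (axis k 1) H) p)"
    by (intro sum.cong refl der_cmult smooth_on_differentiable[OF _ assms(3)] smooth_intros assms)
  finally show ?thesis .
qed

text \<open>\<open>dxy H\<close> is \<open>H\<^sub>x\<^sub>k y\<^sup>k\<close>, with \<open>y\<close> varying; in contrast \<open>dx y H\<close> has a fixed direction \<open>y\<close>.\<close>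

definition dxy :: "('a::real_normed_vector \<times> 'a \<Rightarrow> real) \<Rightarrow> 'a \<times> 'a \<Rightarrow> real" where
  "dxy H p = dx (snd p) H p"

lemma dxy_expansion:
  fixes H :: "(real^'n) \<times> (real^'n) \<Rightarrow> real"
  shows "H differentiable (at p) \<Longrightarrow> dxy H p = (\<Sum>k\<in>UNIV. snd p $ k * dx (axis k 1) H p)"
  unfolding dxy_def by (rule dx_expansion)

lemma smooth_on_dxy [smooth_intros]:
  fixes H :: "(real^'n) \<times> (real^'n) \<Rightarrow> real"
  assumes "open S" "smooth_on H S"
  shows "smooth_on (dxy H) S"
proof -
  have "smooth_on (\<lambda>p. \<Sum>k\<in>UNIV. snd p $ k * dx (axis k 1) H p) S"
    by (intro smooth_intros assms)
  then show ?thesis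
    by (rule smooth_on_transform[OF assms(1) _ dxy_expansion[OF smooth_on_differentiable[OF assms(2)]]])
qed

text \<open>The product rule acts on the moving direction in H_{x^k} y^k. In the first term on the
  right the direction is frozen at its value \<open>snd p\<close>; the second comes from
  differentiating y^k.\<close>

lemma dy_dxy:
  fixes H :: "(real^'n) \<times> (real^'n) \<Rightarrow> real"
  assumes "open S" "smooth_on H S" "p \<in> S"
  shows "dy b (dxy H) p = dy b (dx (snd p) H) p + dx b H p"
proof -
  note diff = smooth_on_differentiable[OF _ assms(3)]
  have "dy b (dxy H) p = dy b (\<lambda>p. \<Sum>k\<in>UNIV. snd p $ k * dx (axis k 1) H p) p"
    by (rule der_cong[OF assms(1,3) dxy_expansion[OF smooth_on_differentiable[OF assms(2)]]])
  also have "\<dots> = (\<Sum>k\<in>UNIV. dy b (\<lambda>p. snd p $ k * dx (axis k 1) H p) p)"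
    by (intro der_sum diff smooth_intros assms)
  also have "\<dots> = (\<Sum>k\<in>UNIV. snd p $ k * dy b (dx (axis k 1) H) p + b $ k * dx (axis k 1) H p)"
  proof (rule sum.cong[OF refl])
    fix k
    show "dy b (\<lambda>p. snd p $ k * dx (axis k 1) H p) p =
        snd p $ k * dy b (dx (axis k 1) H) p + b $ k * dx (axis k 1) H p"
      using der_mult[OF diff[OF smooth_on_snd_nth[OF assms(1)]] diff[OF smooth_on_der[OF assms(2)]],
          of "(0, b)" k "(axis k 1, 0)"] by simp
  qed
  also have "\<dots> = dy b (dx (snd p) H) p + dx b H p"
    by (simp only: sum.distrib der_dx_expansion[OF assms, of "(0, b)" "snd p"]
        dx_expansion[OF diff[OF assms(2)], of b])
  finally show ?thesis .
qed

section \<open>Coordinate derivatives as directional derivatives on the product\<close>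

lemma pd_cong_open:
  assumes "open S" "y \<in> S" "\<And>z. z \<in> S \<Longrightarrow> h z = k z"
  shows "pd i h y = pd i k y"
  unfolding pd_def using frechet_derivative_cong_open[OF assms] by simp

lemma pd_fst:
  fixes H :: "(real^'n::finite) \<times> 'b::real_normed_vector \<Rightarrow> real"
  assumes "H differentiable (at (x, y))"
  shows "pd k (\<lambda>z. H (z, y)) x = dx (axis k 1) H (x, y)"
proof -
  have "((\<lambda>z. (z, y)) has_derivative (\<lambda>v. (v, 0))) (at x)"
    by (auto intro!: derivative_eq_intros)
  from has_derivative_compose[OF this has_derivative_der[OF assms]] show ?thesis
    unfolding pd_def der_def[symmetric] by (rule der_eqI)
qed

lemma pd_snd:
  fixes H :: "'a::real_normed_vector \<times> (real^'n::finite) \<Rightarrow> real"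
  assumes "H differentiable (at (x, y))"
  shows "pd k (\<lambda>v. H (x, v)) y = dy (axis k 1) H (x, y)"
proof -
  have "((\<lambda>v. (x, v)) has_derivative (\<lambda>v. (0, v))) (at y)"
    by (auto intro!: derivative_eq_intros)
  from has_derivative_compose[OF this has_derivative_der[OF assms]] show ?thesis
    unfolding pd_def der_def[symmetric] by (rule der_eqI)
qed

section \<open>Homogeneous functions off the zero section\<close>

abbreviation slit_bundle :: "'a::real_normed_vector set \<Rightarrow> ('a \<times> 'b::real_normed_vector) set" where
  "slit_bundle U \<equiv> U \<times> (- {0})"

lemma open_slit_bundle: "open U \<Longrightarrow> open (slit_bundle U)"
  by (intro open_Times) auto

definition homogeneous_on ::
  "'a set \<Rightarrow> nat \<Rightarrow> ('a::real_normed_vector \<times> 'b::real_normed_vector \<Rightarrow> real) \<Rightarrow> bool" where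
  "homogeneous_on U m H \<longleftrightarrow> (\<forall>x\<in>U. \<forall>y. y \<noteq> 0 \<longrightarrow> (\<forall>t>0. H (x, t *\<^sub>R y) = t ^ m * H (x, y)))"

lemma homogeneous_onD:
  "homogeneous_on U m H \<Longrightarrow> x \<in> U \<Longrightarrow> y \<noteq> 0 \<Longrightarrow> 0 < t \<Longrightarrow> H (x, t *\<^sub>R y) = t ^ m * H (x, y)"
  by (simp add: homogeneous_on_def)

text \<open>Chain rule for the scaling (x, y) \<mapsto> (x, t y). One identity serves both kinds of
  derivative: b = 0 shows that \<open>dx\<close> preserves the degree, a = 0 that \<open>dy\<close>
  lowers it by one.\<close>

lemma der_homogeneous_on:
  fixes H :: "'a::real_normed_vector \<times> 'b::real_normed_vector \<Rightarrow> real"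
  assumes U: "open U" and H: "smooth_on H (slit_bundle U)" and hom: "homogeneous_on U m H"
    and x: "x \<in> U" and y: "y \<noteq> 0" and t: "0 < t"
  shows "der (a, t *\<^sub>R b) H (x, t *\<^sub>R y) = t ^ m * der (a, b) H (x, y)"
proof -
  note diff = smooth_on_differentiable[OF H]
  have "((\<lambda>p. (fst p, t *\<^sub>R snd p)) has_derivative (\<lambda>v. (fst v, t *\<^sub>R snd v))) (at (x, y))"
    by (auto intro!: derivative_eq_intros)
  from has_derivative_compose[OF this, of H "\<lambda>v. der v H (x, t *\<^sub>R y)"]
  have "((\<lambda>p. H (fst p, t *\<^sub>R snd p)) has_derivative (\<lambda>v. der (fst v, t *\<^sub>R snd v) H (x, t *\<^sub>R y))) (at (x, y))"
    using has_derivative_der[OF diff, of "(x, t *\<^sub>R y)"] x y t by simp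
  from der_eqI[OF this]
  have "der (a, t *\<^sub>R b) H (x, t *\<^sub>R y) = der (a, b) (\<lambda>p. H (fst p, t *\<^sub>R snd p)) (x, y)"
    by simp
  also have "\<dots> = der (a, b) (\<lambda>p. t ^ m * H p) (x, y)"
    by (rule der_cong[OF open_slit_bundle[OF U]])
      (use x y in \<open>simp_all add: mem_Times_iff homogeneous_onD[OF hom _ _ t]\<close>)
  also have "\<dots> = t ^ m * der (a, b) H (x, y)"
    by (rule der_cmult[OF diff]) (use x y in auto)
  finally show ?thesis .
qed

lemma homogeneous_on_dx:
  fixes H :: "'a::real_normed_vector \<times> 'b::real_normed_vector \<Rightarrow> real"
  assumes "open U" "smooth_on H (slit_bundle U)" "homogeneous_on U m H"
  shows "homogeneous_on U m (dx a H)"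
  unfolding homogeneous_on_def using der_homogeneous_on[OF assms, of _ _ _ a 0] by simp

lemma homogeneous_on_dy:
  fixes H :: "'a::real_normed_vector \<times> 'b::real_normed_vector \<Rightarrow> real"
  assumes "open U" "smooth_on H (slit_bundle U)" "homogeneous_on U (Suc m) H"
  shows "homogeneous_on U m (dy b H)"
  unfolding homogeneous_on_def
proof (intro ballI allI impI)
  fix x :: 'a and y :: 'b and t :: real
  assume xy: "x \<in> U" "y \<noteq> 0" "0 < t"
  have "H differentiable (at (x, t *\<^sub>R y))"
    using smooth_on_differentiable[OF assms(2)] xy by simp
  then have "dy (t *\<^sub>R b) H (x, t *\<^sub>R y) = t * dy b H (x, t *\<^sub>R y)"
    using linear_scale[OF linear_der, of H "(x, t *\<^sub>R y)" t "(0, b)"] by simp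
  moreover have "dy (t *\<^sub>R b) H (x, t *\<^sub>R y) = t * (t ^ m * dy b H (x, y))"
    using der_homogeneous_on[OF assms xy, of 0 b] by simp
  ultimately show "dy b H (x, t *\<^sub>R y) = t ^ m * dy b H (x, y)"
    using xy(3) by simp
qed

text \<open>Both sides are the derivative of t \<mapsto> H(x, t y) at t = 1, once by the chain rule
  and once from t^m H(x, y).\<close>

lemma euler_identity:
  fixes H :: "'a::real_normed_vector \<times> 'b::real_normed_vector \<Rightarrow> real"
  assumes "smooth_on H (slit_bundle U)" "homogeneous_on U m H" "p \<in> slit_bundle U"
  shows "dy (snd p) H p = m * H p"
proof -
  obtain x y where p: "p = (x, y)"
    by (cases p)
  have xy: "x \<in> U" "y \<noteq> 0"
    using assms(3) p by auto
  have "((\<lambda>t. (x, t *\<^sub>R y)) has_derivative (\<lambda>s. (0, s *\<^sub>R y))) (at 1)"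
    by (auto intro!: derivative_eq_intros)
  from has_derivative_compose[OF this, of H "\<lambda>v. der v H p"]
  have "((\<lambda>t. H (x, t *\<^sub>R y)) has_derivative (\<lambda>s. der (0, s *\<^sub>R y) H p)) (at 1)"
    using has_derivative_der[OF smooth_on_differentiable[OF assms(1,3)]] p by simp
  moreover have "der (0, s *\<^sub>R y) H p = dy y H p * s" for s
    using linear_scale[OF linear_der[OF smooth_on_differentiable[OF assms(1,3)]], of s "(0, y)"] by simp
  ultimately have "((\<lambda>t. H (x, t *\<^sub>R y)) has_real_derivative dy y H p) (at 1)"
    by (simp add: has_field_derivative_def)
  then have "((\<lambda>t. t ^ m * H (x, y)) has_real_derivative dy y H p) (at 1)"
    by (rule has_field_derivative_transform_within_open[of _ _ _ "{0<..}"])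
      (use homogeneous_onD[OF assms(2) xy] in auto)
  moreover have "((\<lambda>t. t ^ m * H (x, y)) has_real_derivative m * H (x, y)) (at 1)"
    by (auto intro!: derivative_eq_intros)
  ultimately show ?thesis
    using DERIV_unique p by auto
qed

lemma dy_euler:
  fixes H :: "'a::real_normed_vector \<times> (real^'n) \<Rightarrow> real"
  assumes U: "open U" and H: "smooth_on H (slit_bundle U)" "homogeneous_on U m H"
    and p: "p \<in> slit_bundle U"
  shows "dy v (dy (snd p) H) p = (real m - 1) * dy v H p"
proof -
  note S = open_slit_bundle[OF U] and diff = smooth_on_differentiable[OF _ p]
  have "real m * H q = (\<Sum>k\<in>UNIV. snd q $ k * dy (axis k 1) H q)" if q: "q \<in> slit_bundle U" for q
    using euler_identity[OF H q] dy_expansion[OF smooth_on_differentiable[OF H(1) q], of "snd q"] by simp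
  then have "dy v (\<lambda>q. real m * H q) p = dy v (\<lambda>q. \<Sum>k\<in>UNIV. snd q $ k * dy (axis k 1) H q) p"
    by (rule der_cong[OF S p])
  also have "\<dots> = (\<Sum>k\<in>UNIV. dy v (\<lambda>q. snd q $ k * dy (axis k 1) H q) p)"
    by (intro der_sum diff smooth_intros S H)
  also have "\<dots> = (\<Sum>k\<in>UNIV. snd p $ k * dy v (dy (axis k 1) H) p + v $ k * dy (axis k 1) H p)"
  proof (rule sum.cong[OF refl])
    fix k
    show "dy v (\<lambda>q. snd q $ k * dy (axis k 1) H q) p =
        snd p $ k * dy v (dy (axis k 1) H) p + v $ k * dy (axis k 1) H p"
      using der_mult[OF diff[OF smooth_on_snd_nth[OF S]] diff[OF smooth_on_der[OF H(1)]],
          of "(0, v)" k "(0, axis k 1)"] by simp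
  qed
  also have "\<dots> = dy v (dy (snd p) H) p + dy v H p"
    by (simp only: sum.distrib der_dy_expansion[OF S H(1) p, of "(0, v)" "snd p"]
        dy_expansion[OF diff[OF H(1)], of v])
  finally show ?thesis
    using der_cmult[OF diff[OF H(1)], of "(0, v)" "real m"] by (simp add: algebra_simps)
qed

section \<open>Geodesic coefficients\<close>

locale finsler_space =
  fixes U :: "(real^'n::finite) set" and F :: "real^'n \<Rightarrow> real^'n \<Rightarrow> real"
  assumes open_U: "open U" and finsler: "finsler_metric U F"
begin

definition f :: "(real^'n) \<times> (real^'n) \<Rightarrow> real" where
  "f p = F (fst p) (snd p)"

definition L :: "(real^'n) \<times> (real^'n) \<Rightarrow> real" where
  "L p = 1/2 * (f p * f p)"

abbreviation S :: "((real^'n) \<times> (real^'n)) set" where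
  "S \<equiv> slit_bundle U"

lemmas open_S = open_slit_bundle[OF open_U, where 'b = "real^'n"]

lemmas diff = smooth_on_differentiable[where S = S]

lemma smooth_f [smooth_intros]: "smooth_on f S"
proof -
  have "f = (\<lambda>(x, y). F x y)"
    by (auto simp: f_def)
  then show ?thesis
    using finsler by (simp add: finsler_metric_def)
qed

lemma smooth_L [smooth_intros]: "smooth_on L S"
  unfolding L_def[abs_def] by (intro smooth_intros open_S)

lemma minkowski: "x \<in> U \<Longrightarrow> minkowski_norm (F x)"
  using finsler by (simp add: finsler_metric_def)

lemma f_pos: "p \<in> S \<Longrightarrow> 0 < f p"
  using minkowski[of "fst p"] unfolding minkowski_norm_def f_def
  by (metis mem_Times_iff ComplD insertI1 order_less_le)

lemma homogeneous_f: "homogeneous_on U 1 f"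
  using minkowski unfolding minkowski_norm_def homogeneous_on_def pos_homogeneous_def f_def by simp

lemma homogeneous_L: "homogeneous_on U 2 L"
  using homogeneous_f unfolding homogeneous_on_def L_def by (simp add: power2_eq_square)

lemma der_L: "p \<in> S \<Longrightarrow> der v L p = f p * der v f p"
  unfolding L_def[abs_def]
  by (subst der_cmult) (simp_all add: diff der_mult smooth_on_mult open_S smooth_f)

lemma der_der_L:
  assumes "p \<in> S"
  shows "der w (der v L) p = der w f p * der v f p + f p * der w (der v f) p"
proof -
  have "der w (der v L) p = der w (\<lambda>p. f p * der v f p) p"
    by (rule der_cong[OF open_S assms der_L])
  also have "\<dots> = f p * der w (der v f) p + der w f p * der v f p"
    by (intro der_mult diff smooth_intros open_S assms)
  finally show ?thesis
    by simp
qed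

section \<open>The fundamental tensor as the Hessian of half the square\<close>

lemma fund_tensor_entry:
  assumes p: "(x, y) \<in> S"
  shows "fund_tensor F x y $ i $ j = dy (axis j 1) (dy (axis i 1) L) (x, y)"
proof -
  have "pd j (pd i (\<lambda>z. 1/2 * (F x z)\<^sup>2)) y = pd j (\<lambda>z. dy (axis i 1) L (x, z)) y"
  proof (rule pd_cong_open[of "- {0}"])
    fix z :: "real^'n" assume "z \<in> - {0}"
    then have "(x, z) \<in> S"
      using p by auto
    then show "pd i (\<lambda>z. 1/2 * (F x z)\<^sup>2) z = dy (axis i 1) L (x, z)"
      using pd_snd[OF diff[OF smooth_L]] by (simp add: L_def f_def power2_eq_square)
  qed (use p in auto)
  also have "\<dots> = dy (axis j 1) (dy (axis i 1) L) (x, y)"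
    by (intro pd_snd diff smooth_intros p)
  finally show ?thesis
    by (simp add: fund_tensor_def half_sq_hessian_def)
qed

lemma fund_tensor_sum:
  assumes p: "(x, y) \<in> S"
  shows "(\<Sum>i\<in>UNIV. \<Sum>j\<in>UNIV. fund_tensor F x y $ i $ j * v $ i * w $ j) = dy w (dy v L) (x, y)"
proof -
  have "dy w (dy v L) (x, y) = (\<Sum>i\<in>UNIV. v $ i * dy w (dy (axis i 1) L) (x, y))"
    by (rule der_dy_expansion[OF open_S smooth_L p])
  also have "\<dots> = (\<Sum>i\<in>UNIV. v $ i * (\<Sum>j\<in>UNIV. w $ j * dy (axis j 1) (dy (axis i 1) L) (x, y)))"
    by (intro sum.cong refl arg_cong2[where f = "(*)"] dy_expansion diff smooth_intros p)
  finally show ?thesis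
    by (simp add: fund_tensor_entry[OF p] sum_distrib_left mult_ac)
qed

lemma fund_tensor_inner:
  assumes p: "(x, y) \<in> S"
  shows "v \<bullet> (fund_tensor F x y *v w) = dy w (dy v L) (x, y)"
  unfolding fund_tensor_sum[OF p, symmetric] inner_vec_def matrix_vector_mult_def
  by (simp add: sum_distrib_left mult_ac)

lemma L_yy_pos:
  assumes "p \<in> S" "v \<noteq> 0"
  shows "0 < dy v (dy v L) p"
proof -
  obtain x y where p: "p = (x, y)"
    by (cases p)
  then have "x \<in> U" "y \<noteq> 0"
    using assms by auto
  then have "pos_definite (fund_tensor F x y)"
    using minkowski[of x] by (simp add: minkowski_norm_def fund_tensor_def)
  then have "0 < v \<bullet> (fund_tensor F x y *v v)"
    using assms(2) by (simp add: pos_definite_def)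
  then show ?thesis
    using assms(1) fund_tensor_inner[of x y v v] by (simp only: p)
qed

lemma fund_tensor_eq_0:
  assumes p: "(x, y) \<in> S" and "fund_tensor F x y *v w = 0"
  shows "w = 0"
  using L_yy_pos[OF p, of w] fund_tensor_inner[OF p, of w w] assms(2) by fastforce

lemma fund_tensor_det:
  assumes "(x, y) \<in> S"
  shows "det (fund_tensor F x y) \<noteq> 0"
  using fund_tensor_eq_0[OF assms] matrix_left_invertible_ker[of "fund_tensor F x y"]
    invertible_det_nz[of "fund_tensor F x y"] invertible_left_inverse by blast

text \<open>The two orders of differentiation have different sources: the first is Euler's identity
  for \<open>dy v L\<close>, of degree one, the second the differentiated Euler identity for
  \<open>L\<close>, of degree two. Together they say g(y, v) = g(v, y) = L_v.\<close>

lemma L_yy: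
  assumes "p \<in> S"
  shows "dy (snd p) (dy v L) p = dy v L p" "dy v (dy (snd p) L) p = dy v L p"
  using euler_identity[OF smooth_on_der[OF smooth_L]
      homogeneous_on_dy[OF open_U smooth_L, of 1] assms]
    homogeneous_L dy_euler[OF open_U smooth_L homogeneous_L assms, of v]
  by (simp_all add: numeral_2_eq_2)

lemma geod_coeff_rhs:
  assumes p: "(x, y) \<in> S"
  shows "(\<Sum>m\<in>UNIV. pd l (\<lambda>v. pd m (\<lambda>z. (F z v)\<^sup>2) x) y * y $ m) - pd l (\<lambda>z. (F z y)\<^sup>2) x
    = 2 * (\<Sum>m\<in>UNIV. y $ m * dy (axis l 1) (dx (axis m 1) L) (x, y)) - 2 * dx (axis l 1) L (x, y)"
proof -
  have sq: "(F z v)\<^sup>2 = 2 * L (z, v)" for z v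
    by (simp add: L_def f_def power2_eq_square)
  have 1: "pd m (\<lambda>z. (F z v)\<^sup>2) x = 2 * dx (axis m 1) L (x, v)" if "v \<noteq> 0" for m v
  proof -
    have q: "(x, v) \<in> S"
      using p that by auto
    show ?thesis
      unfolding sq pd_fst[of "\<lambda>p. 2 * L p" x v,
          OF diff[OF smooth_on_mult[OF open_S smooth_on_const[OF open_S] smooth_L] q]]
      by (rule der_cmult[OF diff[OF smooth_L q]])
  qed
  have "pd l (\<lambda>v. pd m (\<lambda>z. (F z v)\<^sup>2) x) y = 2 * dy (axis l 1) (dx (axis m 1) L) (x, y)" for m
  proof -
    have "pd l (\<lambda>v. pd m (\<lambda>z. (F z v)\<^sup>2) x) y = pd l (\<lambda>v. 2 * dx (axis m 1) L (x, v)) y"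
      by (rule pd_cong_open[of "- {0}"]) (use p in \<open>auto intro: 1\<close>)
    also have "\<dots> = dy (axis l 1) (\<lambda>p. 2 * dx (axis m 1) L p) (x, y)"
      by (intro pd_snd[of "\<lambda>p. 2 * dx (axis m 1) L p"] diff[OF _ p] smooth_intros open_S)
    also have "\<dots> = 2 * dy (axis l 1) (dx (axis m 1) L) (x, y)"
      by (intro der_cmult diff[OF _ p] smooth_intros)
    finally show ?thesis .
  qed
  then show ?thesis
    using 1[of y l] p by (simp add: sum_distrib_left mult_ac)
qed

lemma smooth_fund_tensor: "smooth_on (\<lambda>p. fund_tensor F (fst p) (snd p) $ i $ j) S"
  by (rule smooth_on_transform[OF open_S, of "dy (axis j 1) (dy (axis i 1) L)"])
    (auto intro: smooth_intros simp: fund_tensor_entry)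

text \<open>Makes the geodesic equation locally Lipschitz. Cramer's rule handles the inverse of the
  fundamental tensor, whose determinant is nonzero by positive definiteness.\<close>

lemma smooth_geod_coeff: "smooth_on (\<lambda>p. geod_coeff F (fst p) (snd p)) S"
proof (rule smooth_on_vec[OF open_S])
  fix i
  have "smooth_on (\<lambda>p. 1/4 * (\<Sum>l\<in>UNIV. matrix_inv (fund_tensor F (fst p) (snd p)) $ i $ l *
     (2 * (\<Sum>m\<in>UNIV. snd p $ m * dy (axis l 1) (dx (axis m 1) L) p) - 2 * dx (axis l 1) L p))) S"
    by (intro smooth_intros open_S smooth_fund_tensor) (simp add: fund_tensor_det mem_Times_iff)
  then show "smooth_on (\<lambda>p. geod_coeff F (fst p) (snd p) $ i) S"
    by (rule smooth_on_transform[OF open_S]) (auto simp: geod_coeff_def geod_coeff_rhs)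
qed

text \<open>The defining formula says g G = r with g invertible. Pairing with every \<open>b\<close>
  removes the matrix inverse and leaves an equation in which any candidate \<open>w\<close> can be
  tested.\<close>

lemma geod_coeff_eq_iff:
  assumes p: "p \<in> S"
  shows "geod_coeff F (fst p) (snd p) = w \<longleftrightarrow>
    (\<forall>b. dy w (dy b L) p = (dy b (dx (snd p) L) p - dx b L p) / 2)"
proof -
  obtain x y where xy: "p = (x, y)"
    by (cases p)
  note q = p[unfolded xy]
  define A where "A = fund_tensor F x y"
  define r :: "real^'n" where
    "r = (\<chi> l. (dy (axis l 1) (dx y L) (x, y) - dx (axis l 1) L (x, y)) / 2)"
  have "1/4 * (2 * (\<Sum>m\<in>UNIV. y $ m * dy (axis l 1) (dx (axis m 1) L) (x, y)) - 2 * dx (axis l 1) L (x, y))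
      = r $ l" for l
    using der_dx_expansion[OF open_S smooth_L q, of "(0, axis l 1)" y] by (simp add: r_def)
  then have "geod_coeff F x y $ i = (\<Sum>l\<in>UNIV. matrix_inv A $ i $ l * r $ l)" for i
    unfolding geod_coeff_def A_def geod_coeff_rhs[OF q]
    by (simp only: vec_lambda_beta sum_distrib_left mult.left_commute[of "1/4"])
  then have "geod_coeff F x y = matrix_inv A *v r"
    by (simp add: vec_eq_iff matrix_vector_mult_def)
  then have "A *v geod_coeff F x y = r"
    using matrix_mul_matrix_inv[OF fund_tensor_det[OF q]]
    by (simp add: A_def matrix_vector_mul_assoc)
  moreover have "w = w'" if "A *v w = A *v w'" for w'
    using fund_tensor_eq_0[OF q, of "w - w'"] that
    by (simp add: A_def matrix_vector_mult_diff_distrib)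
  ultimately have "geod_coeff F x y = w \<longleftrightarrow> A *v w = r"
    by metis
  also have "\<dots> \<longleftrightarrow> (\<forall>b. b \<bullet> (A *v w) = b \<bullet> r)"
    by (metis vector_eq_ldot)
  finally have "geod_coeff F x y = w \<longleftrightarrow> (\<forall>b. b \<bullet> (A *v w) = b \<bullet> r)" .
  moreover have "b \<bullet> r = (dy b (dx y L) (x, y) - dx b L (x, y)) / 2" for b
    unfolding dy_expansion[OF diff[OF smooth_on_der[OF smooth_L] q], of b]
      dx_expansion[OF diff[OF smooth_L q], of b] inner_vec_def
    by (simp add: r_def sum_subtractf right_diff_distrib diff_divide_distrib sum_divide_distrib)
  ultimately show ?thesis
    by (simp add: xy A_def fund_tensor_inner[OF q])
qed

section \<open>The projective factor and Hamel's equation\<close>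

definition P :: "(real^'n) \<times> (real^'n) \<Rightarrow> real" where
  "P p = dxy f p / (2 * f p)"

lemma smooth_P [smooth_intros]: "smooth_on P S"
  unfolding P_def[abs_def]
  by (intro smooth_intros open_S) (use f_pos in force)

lemma dxy_f: "p \<in> S \<Longrightarrow> dxy f p = 2 * (P p * f p)"
  using f_pos[of p] by (simp add: P_def)

lemma proj_factor_eq:
  assumes p: "(x, y) \<in> S"
  shows "proj_factor F x y = P (x, y)"
proof -
  have "pd k (\<lambda>z. F z y) x = dx (axis k 1) f (x, y)" for k
    using pd_fst[OF diff[OF smooth_f p]] by (simp add: f_def)
  then show ?thesis
    using dxy_expansion[OF diff[OF smooth_f p]]
    by (simp add: P_def proj_factor_def f_def mult.commute)
qed

lemma homogeneous_P: "homogeneous_on U 1 P"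
  unfolding homogeneous_on_def
proof (intro ballI allI impI)
  fix x y :: "real^'n" and t :: real
  assume xy: "x \<in> U" "y \<noteq> 0" "0 < t"
  have q: "(x, y) \<in> S" "(x, t *\<^sub>R y) \<in> S"
    using xy by auto
  have "dxy f (x, t *\<^sub>R y) = t * dx y f (x, t *\<^sub>R y)"
    using linear_scale[OF linear_der[OF diff[OF smooth_f q(2)]], of t "(y, 0)"] by (simp add: dxy_def)
  also have "dx y f (x, t *\<^sub>R y) = t * dx y f (x, y)"
    using homogeneous_onD[OF homogeneous_on_dx[OF open_U smooth_f homogeneous_f] xy, of y] by simp
  finally have "dxy f (x, t *\<^sub>R y) = t * t * dxy f (x, y)"
    by (simp add: dxy_def)
  then show "P (x, t *\<^sub>R y) = t ^ 1 * P (x, y)"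
    using homogeneous_onD[OF homogeneous_f xy] f_pos[OF q(1)] xy(3) by (simp add: P_def)
qed

text \<open>Write F_b for the y-derivative of F along b. For w = c y, Euler's identities and
  division by F reduce the equation for G to c F_b = P F_b + (\<open>dy b (dx y f)\<close> -
  \<open>dx b f\<close>) / 2. Taking b = y kills the bracket and forces c = P, after which the
  bracket vanishes for every b. Differentiating F_{x^k} y^k = 2 P F turns that into Hamel's
  equation.\<close>

lemma geod_coeff_proportional_iff:
  assumes p: "p \<in> S"
  shows "geod_coeff F (fst p) (snd p) = c *\<^sub>R snd p \<longleftrightarrow>
    c = P p \<and> (\<forall>b. dx b f p = dy b (\<lambda>p. P p * f p) p)"
proof -
  let ?y = "snd p"
  have f0: "0 < f p"
    by (rule f_pos[OF p])
  have lhs: "dy (c *\<^sub>R ?y) (dy b L) p = c * (f p * dy b f p)" for b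
    using linear_scale[OF linear_der[OF diff[OF smooth_on_der[OF smooth_L] p]], of c "(0, ?y)" "(0, b)"]
    by (simp add: L_yy[OF p] der_L[OF p])
  have rhs: "(dy b (dx ?y L) p - dx b L p) / 2 =
      f p * (P p * dy b f p + (dy b (dx ?y f) p - dx b f p) / 2)" for b
    using dxy_f[OF p] unfolding der_der_L[OF p] der_L[OF p] by (simp add: dxy_def field_simps)
  have "geod_coeff F (fst p) ?y = c *\<^sub>R ?y \<longleftrightarrow>
      (\<forall>b. c * dy b f p = P p * dy b f p + (dy b (dx ?y f) p - dx b f p) / 2)" (is "_ \<longleftrightarrow> (\<forall>b. ?E b)")
    unfolding geod_coeff_eq_iff[OF p] lhs rhs mult.left_commute[of c "f p"] using f0 by simp
  also have "\<dots> \<longleftrightarrow> c = P p \<and> (\<forall>b. dy b (dx ?y f) p = dx b f p)"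
  proof
    assume E: "\<forall>b. ?E b"
    have "dy ?y f p = f p" "dy ?y (dx ?y f) p = dx ?y f p"
      using euler_identity[OF smooth_f homogeneous_f p]
        euler_identity[OF smooth_on_der[OF smooth_f] homogeneous_on_dx[OF open_U smooth_f homogeneous_f] p]
      by simp_all
    with E have "c = P p"
      using f0 spec[OF E, of ?y] by simp
    with E show "c = P p \<and> (\<forall>b. dy b (dx ?y f) p = dx b f p)"
      by simp
  qed simp
  finally have "geod_coeff F (fst p) ?y = c *\<^sub>R ?y \<longleftrightarrow> c = P p \<and> (\<forall>b. dy b (dx ?y f) p = dx b f p)" .
  moreover have "dy b (dx ?y f) p = dx b f p \<longleftrightarrow> dx b f p = dy b (\<lambda>p. P p * f p) p" for b
  proof -
    have "dy b (dxy f) p = dy b (\<lambda>p. 2 * (P p * f p)) p"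
      by (rule der_cong[OF open_S p dxy_f])
    also have "\<dots> = 2 * dy b (\<lambda>p. P p * f p) p"
      by (intro der_cmult diff[OF _ p] smooth_intros open_S)
    finally show ?thesis
      using dy_dxy[OF open_S smooth_f p, of b] by linarith
  qed
  ultimately show ?thesis
    by simp
qed

text \<open>Q F has degree two, so contracting the equation with y gives F_{x^k} y^k = 2 Q F, which
  is the formula defining \<open>P\<close>.\<close>

lemma hamel_unique:
  assumes Q: "smooth_on Q S" "homogeneous_on U 1 Q"
    and h: "\<And>p b. p \<in> S \<Longrightarrow> dx b f p = dy b (\<lambda>p. Q p * f p) p" and p: "p \<in> S"
  shows "Q p = P p"
proof -
  have "homogeneous_on U 2 (\<lambda>p. Q p * f p)"
    using Q(2) homogeneous_f unfolding homogeneous_on_def by (simp add: power2_eq_square)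
  from euler_identity[OF smooth_on_mult[OF open_S Q(1) smooth_f] this p]
  have "dx (snd p) f p = 2 * (Q p * f p)"
    using h[OF p] by simp
  then show ?thesis
    using dxy_f[OF p] f_pos[OF p] by (simp add: dxy_def)
qed

end

section \<open>Flag curvature\<close>

text \<open>The index sums in the Riemann curvature of G = P y, with a_j = P_{x^j}, b_j = P_{y^j},
  and a', b' their derivatives in y^k. The hypotheses on b and b' are Euler identities for degree
  one. The terms P b_k y^i occur with weights 2 and - 3, the terms P P \<delta> with weights 2 and -
  1.\<close>

lemma riemann_sum_algebra:
  fixes y a a' b b' :: "'n::finite \<Rightarrow> real" and \<delta> :: "'n \<Rightarrow> 'n \<Rightarrow> real"
  assumes \<delta>: "\<And>i j. \<delta> i j = (if i = j then 1 else 0)"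
    and a: "(\<Sum>j\<in>UNIV. y j * a j) = X" and a': "(\<Sum>j\<in>UNIV. y j * a' j) = X'"
    and b: "(\<Sum>j\<in>UNIV. y j * b j) = P" and b': "(\<Sum>j\<in>UNIV. y j * b' j) = 0"
  shows "2 * (a k * y i) - (\<Sum>j\<in>UNIV. y j * (a j * \<delta> i k + a' j * y i))
      + 2 * (\<Sum>j\<in>UNIV. P * y j * (b k * \<delta> i j + b j * \<delta> i k + b' j * y i))
      - (\<Sum>j\<in>UNIV. (P * \<delta> i j + b j * y i) * (P * \<delta> j k + b k * y j))
    = (P * P - X) * \<delta> i k + (2 * a k - X' - P * b k) * y i"
proof -
  have d1: "(\<Sum>j\<in>UNIV. \<delta> i j * h j) = h i" for h
    by (simp add: \<delta> if_distrib[of "\<lambda>z. z * _"] cong: if_cong)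
  have d2: "(\<Sum>j\<in>UNIV. \<delta> j k * h j) = h k" for h
    by (simp add: \<delta> if_distrib[of "\<lambda>z. z * _"] cong: if_cong)
  have "(\<Sum>j\<in>UNIV. y j * (a j * \<delta> i k + a' j * y i)) =
      (\<Sum>j\<in>UNIV. \<delta> i k * (y j * a j) + y i * (y j * a' j))"
    by (intro sum.cong refl) (simp add: algebra_simps)
  then have 1: "(\<Sum>j\<in>UNIV. y j * (a j * \<delta> i k + a' j * y i)) = X * \<delta> i k + X' * y i"
    by (simp add: sum.distrib sum_distrib_left[symmetric] a a')
  have "(\<Sum>j\<in>UNIV. P * y j * (b k * \<delta> i j + b j * \<delta> i k + b' j * y i)) =
      (\<Sum>j\<in>UNIV. (P * b k) * (\<delta> i j * y j) + (P * \<delta> i k) * (y j * b j) + (P * y i) * (y j * b' j))"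
    by (intro sum.cong refl) (simp add: algebra_simps)
  then have 2: "(\<Sum>j\<in>UNIV. P * y j * (b k * \<delta> i j + b j * \<delta> i k + b' j * y i)) =
      P * b k * y i + P * \<delta> i k * P"
    by (simp add: sum.distrib sum_distrib_left[symmetric] b b' d1)
  have "(\<Sum>j\<in>UNIV. (P * \<delta> i j + b j * y i) * (P * \<delta> j k + b k * y j)) =
      (\<Sum>j\<in>UNIV. (P * P) * (\<delta> i j * \<delta> j k) + (P * b k) * (\<delta> i j * y j)
        + (P * y i) * (\<delta> j k * b j) + (y i * b k) * (y j * b j))"
    by (intro sum.cong refl) (simp add: algebra_simps)
  then have 3: "(\<Sum>j\<in>UNIV. (P * \<delta> i j + b j * y i) * (P * \<delta> j k + b k * y j)) =
      P * P * \<delta> i k + 3 * (P * b k * y i)"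
    by (simp add: sum.distrib sum_distrib_left[symmetric] b d1 d2)
  show ?thesis
    unfolding 1 2 3 by (simp add: algebra_simps)
qed

lemma dim_pair_eq_2_iff:
  fixes y u :: "'a::euclidean_space"
  shows "dim {y, u} = 2 \<longleftrightarrow> y \<noteq> 0 \<and> (\<forall>c. u \<noteq> c *\<^sub>R y)"
proof
  assume d: "dim {y, u} = 2"
  have "dim {y, u} \<le> 1" if ex: "\<exists>z. y \<in> span {z} \<and> u \<in> span {z}"
  proof -
    obtain z where "y \<in> span {z}" "u \<in> span {z}"
      using ex by blast
    then have "dim {y, u} \<le> dim {z}"
      using dim_subset[of "{y, u}" "span {z}"] by simp
    also have "\<dots> \<le> 1"
      using dim_le_card'[of "{z}"] by simp
    finally show ?thesis .
  qed
  moreover have "y \<in> span {u}" if "y = 0"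
    using that by (simp add: span_zero)
  moreover have "u \<in> span {y}" if "u = c *\<^sub>R y" for c
    using that by (simp add: span_base span_scale)
  ultimately show "y \<noteq> 0 \<and> (\<forall>c. u \<noteq> c *\<^sub>R y)"
    using d span_base[of u "{u}"] span_base[of y "{y}"] by force
next
  assume *: "y \<noteq> 0 \<and> (\<forall>c. u \<noteq> c *\<^sub>R y)"
  then have "u \<notin> span {y}"
    by (auto simp: span_singleton)
  then have "independent {u, y}"
    using * by (simp add: independent_insert)
  moreover have "u \<noteq> y"
    using * by (metis scaleR_one)
  ultimately have "dim {u, y} = 2"
    by (simp add: dim_eq_card_independent)
  then show "dim {y, u} = 2"
    by (simp add: insert_commute)
qed

context finsler_space
begin

text \<open>In coordinates, \<open>hamel\<close> is \<open>F\<^sub>x\<^sub>k = (P F)\<^sub>y\<^sub>k\<close> and \<open>riccati\<close> is \<open>P\<^sub>x\<^sub>k = P P\<^sub>y\<^sub>k + F F\<^sub>y\<^sub>k\<close>.\<close>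

definition hamel :: bool where
  "hamel \<longleftrightarrow> (\<forall>p\<in>S. \<forall>b. dx b f p = dy b (\<lambda>p. P p * f p) p)"

definition riccati :: bool where
  "riccati \<longleftrightarrow> (\<forall>p\<in>S. \<forall>b. dx b P p = P p * dy b P p + f p * dy b f p)"

lemma hamel_iff: "hamel \<longleftrightarrow> (\<forall>p\<in>S. \<exists>c. geod_coeff F (fst p) (snd p) = c *\<^sub>R snd p)"
  unfolding hamel_def by (simp add: geod_coeff_proportional_iff)

lemma hamel_geod_coeff:
  "hamel \<Longrightarrow> p \<in> S \<Longrightarrow> geod_coeff F (fst p) (snd p) = P p *\<^sub>R snd p"
  unfolding hamel_def by (subst geod_coeff_proportional_iff) auto

lemma dy_P_y: "p \<in> S \<Longrightarrow> dy (snd p) P p = P p"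
  using euler_identity[OF smooth_P homogeneous_P] by simp

lemma dy_f_y: "p \<in> S \<Longrightarrow> dy (snd p) f p = f p"
  using euler_identity[OF smooth_f homogeneous_f] by simp

text \<open>If \<open>G = P y\<close>, then \<open>R\<^sup>i\<^sub>k = curv_scalar \<delta>\<^sup>i\<^sub>k + curv_form(e\<^sub>k) y\<^sup>i\<close>.\<close>

definition curv_scalar :: "(real^'n) \<times> (real^'n) \<Rightarrow> real" where
  "curv_scalar p = P p * P p - dxy P p"

definition curv_form :: "real^'n \<Rightarrow> (real^'n) \<times> (real^'n) \<Rightarrow> real" where
  "curv_form u p = 2 * dx u P p - dy u (dx (snd p) P) p - P p * dy u P p"

lemma der_spray:
  "p \<in> S \<Longrightarrow> der v (\<lambda>p. P p * snd p $ i) p = P p * snd v $ i + der v P p * snd p $ i"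
  using der_mult[OF diff[OF smooth_P] diff[OF smooth_on_snd_nth[OF open_S]]] by simp

lemma riemann_curv_entry:
  assumes h: hamel and p: "p \<in> S"
  shows "riemann_curv F (fst p) (snd p) $ i $ k =
    curv_scalar p * (if i = k then 1 else 0) + curv_form (axis k 1) p * snd p $ i"
proof -
  obtain x y where xy: "p = (x, y)"
    by (cases p)
  define \<delta> :: "'n \<Rightarrow> 'n \<Rightarrow> real" where "\<delta> i j = (if i = j then 1 else 0)" for i j
  have \<delta>: "axis j 1 $ i = \<delta> i j" for i j
    by (simp add: \<delta>_def axis_def)
  have G: "geod_coeff F z v $ i = P (z, v) * v $ i" if "(z, v) \<in> S" for z v i
    using hamel_geod_coeff[OF h that] by simp
  have q: "(x, y) \<in> S" and x: "x \<in> U" and y: "y \<in> - {0}"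
    using p xy by auto
  note sP = smooth_on_mult[OF open_S smooth_P smooth_on_snd_nth[OF open_S]]
  have Gx: "pd k (\<lambda>z. geod_coeff F z v $ i) x = dx (axis k 1) P (x, v) * v $ i" if "v \<in> - {0}" for i k v
  proof -
    have r: "(x, v) \<in> S"
      using that x by auto
    have "pd k (\<lambda>z. geod_coeff F z v $ i) x = pd k (\<lambda>z. P (z, v) * v $ i) x"
      by (rule pd_cong_open[OF open_U x]) (use that in \<open>auto intro: G\<close>)
    also have "\<dots> = dx (axis k 1) (\<lambda>p. P p * snd p $ i) (x, v)"
      using pd_fst[OF diff[OF sP r]] by simp
    finally show ?thesis
      by (simp add: der_spray[OF r])
  qed
  have Gy: "pd k (\<lambda>v. geod_coeff F x v $ i) v = P (x, v) * \<delta> i k + dy (axis k 1) P (x, v) * v $ i"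
    if "v \<in> - {0}" for i k v
  proof -
    have r: "(x, v) \<in> S"
      using that x by auto
    have "pd k (\<lambda>v. geod_coeff F x v $ i) v = pd k (\<lambda>v. P (x, v) * v $ i) v"
      by (rule pd_cong_open[OF _ that]) (use x in \<open>auto intro: G\<close>)
    also have "\<dots> = dy (axis k 1) (\<lambda>p. P p * snd p $ i) (x, v)"
      using pd_snd[OF diff[OF sP r]] by simp
    finally show ?thesis
      by (simp add: der_spray[OF r] \<delta>)
  qed
  have Gxy: "pd k (\<lambda>v. pd j (\<lambda>z. geod_coeff F z v $ i) x) y =
      dx (axis j 1) P p * \<delta> i k + dy (axis k 1) (dx (axis j 1) P) p * y $ i" for i j k
  proof -
    have "pd k (\<lambda>v. pd j (\<lambda>z. geod_coeff F z v $ i) x) y = pd k (\<lambda>v. dx (axis j 1) P (x, v) * v $ i) y"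
      by (rule pd_cong_open[OF _ y]) (auto intro: Gx)
    also have "\<dots> = dy (axis k 1) (\<lambda>p. dx (axis j 1) P p * snd p $ i) (x, y)"
      using pd_snd[OF diff[OF smooth_on_mult[OF open_S smooth_on_der[OF smooth_P]
            smooth_on_snd_nth[OF open_S]] q]] by simp
    also have "\<dots> = dx (axis j 1) P p * \<delta> i k + dy (axis k 1) (dx (axis j 1) P) p * y $ i"
      using der_mult[OF diff[OF smooth_on_der[OF smooth_P] q] diff[OF smooth_on_snd_nth[OF open_S] q]]
      by (simp add: xy \<delta>)
    finally show ?thesis .
  qed
  have Gyy: "pd k (pd j (\<lambda>v. geod_coeff F x v $ i)) y =
      dy (axis k 1) P p * \<delta> i j + dy (axis j 1) P p * \<delta> i k + dy (axis k 1) (dy (axis j 1) P) p * y $ i"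
    for i j k
  proof -
    have "pd k (pd j (\<lambda>v. geod_coeff F x v $ i)) y =
        pd k (\<lambda>v. P (x, v) * \<delta> i j + dy (axis j 1) P (x, v) * v $ i) y"
      by (rule pd_cong_open[OF _ y]) (auto intro: Gy)
    also have "\<dots> = dy (axis k 1) (\<lambda>p. P p * \<delta> i j + dy (axis j 1) P p * snd p $ i) (x, y)"
      using pd_snd[OF diff[OF smooth_on_add[OF open_S
              smooth_on_mult[OF open_S smooth_P smooth_on_const[OF open_S, of "\<delta> i j"]]
              smooth_on_mult[OF open_S smooth_on_der[OF smooth_P, of "(0, axis j 1)"]
                smooth_on_snd_nth[OF open_S, of i]]] q]]
      by simp
    also have "\<dots> = dy (axis k 1) (\<lambda>p. P p * \<delta> i j) (x, y)
        + dy (axis k 1) (\<lambda>p. dy (axis j 1) P p * snd p $ i) (x, y)"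
      by (intro der_add diff[OF _ q] smooth_intros open_S)
    also have "dy (axis k 1) (\<lambda>p. P p * \<delta> i j) (x, y) = dy (axis k 1) P p * \<delta> i j"
      using der_cmult[OF diff[OF smooth_P q], of "(0, axis k 1)" "\<delta> i j"] by (simp add: xy mult.commute)
    also have "dy (axis k 1) (\<lambda>p. dy (axis j 1) P p * snd p $ i) (x, y) =
        dy (axis j 1) P p * \<delta> i k + dy (axis k 1) (dy (axis j 1) P) p * y $ i"
      using der_mult[OF diff[OF smooth_on_der[OF smooth_P] q] diff[OF smooth_on_snd_nth[OF open_S] q]]
      by (simp add: xy \<delta>)
    finally show ?thesis
      by simp
  qed
  have s1: "(\<Sum>j\<in>UNIV. y $ j * dx (axis j 1) P p) = dxy P p"
    using dxy_expansion[OF diff[OF smooth_P p]] by (simp add: xy)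
  have s2: "(\<Sum>j\<in>UNIV. y $ j * dy (axis k 1) (dx (axis j 1) P) p) = dy (axis k 1) (dx y P) p"
    by (rule der_dx_expansion[OF open_S smooth_P p, symmetric])
  have s3: "(\<Sum>j\<in>UNIV. y $ j * dy (axis j 1) P p) = P p"
    using dy_expansion[OF diff[OF smooth_P p], of y] dy_P_y[OF p] by (simp add: xy)
  \<comment> \<open>P_y is homogeneous of degree zero: the factor m - 1 in \<open>dy_euler\<close>
    vanishes for m = 1.\<close>
  have s4: "(\<Sum>j\<in>UNIV. y $ j * dy (axis k 1) (dy (axis j 1) P) p) = 0"
    using der_dy_expansion[OF open_S smooth_P p, of "(0, axis k 1)" y]
      dy_euler[OF open_U smooth_P homogeneous_P p, of "axis k 1"] by (simp add: xy)
  have "riemann_curv F x y $ i $ k =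
      2 * (dx (axis k 1) P p * y $ i)
      - (\<Sum>j\<in>UNIV. y $ j * (dx (axis j 1) P p * \<delta> i k + dy (axis k 1) (dx (axis j 1) P) p * y $ i))
      + 2 * (\<Sum>j\<in>UNIV. P p * y $ j * (dy (axis k 1) P p * \<delta> i j + dy (axis j 1) P p * \<delta> i k
          + dy (axis k 1) (dy (axis j 1) P) p * y $ i))
      - (\<Sum>j\<in>UNIV. (P p * \<delta> i j + dy (axis j 1) P p * y $ i) * (P p * \<delta> j k + dy (axis k 1) P p * y $ j))"
    unfolding riemann_curv_def Let_def vec_lambda_beta Gxy Gyy
    by (simp only: Gx[OF y] Gy[OF y] G[OF q] xy)
  also have "\<dots> = (P p * P p - dxy P p) * \<delta> i k
      + (2 * dx (axis k 1) P p - dy (axis k 1) (dx y P) p - P p * dy (axis k 1) P p) * y $ i"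
    using riemann_sum_algebra[where \<delta> = \<delta> and y = "\<lambda>j. y $ j" and P = "P p" and i = i and k = k
        and a = "\<lambda>j. dx (axis j 1) P p" and a' = "\<lambda>j. dy (axis k 1) (dx (axis j 1) P) p"
        and b = "\<lambda>j. dy (axis j 1) P p" and b' = "\<lambda>j. dy (axis k 1) (dy (axis j 1) P) p",
        OF \<delta>_def s1 s2 s3 s4] .
  finally have "riemann_curv F x y $ i $ k = (P p * P p - dxy P p) * \<delta> i k
      + (2 * dx (axis k 1) P p - dy (axis k 1) (dx y P) p - P p * dy (axis k 1) P p) * y $ i" .
  moreover have "fst p = x" "snd p = y"
    by (simp_all add: xy)
  ultimately show ?thesis
    by (simp only: curv_scalar_def curv_form_def \<delta>_def)
qed

lemma linear_curv_form:
  assumes p: "p \<in> S"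
  shows "linear (\<lambda>u. curv_form u p)"
proof -
  have "linear (\<lambda>u. 2 *\<^sub>R dx u P p - dy u (dx (snd p) P) p - P p *\<^sub>R dy u P p)"
    by (intro linear_compose_sub linear_compose_scale_right linear_dx linear_dy diff[OF _ p]
        smooth_intros)
  then show ?thesis
    unfolding curv_form_def real_scaleR_def .
qed

lemma curv_form_expansion:
  assumes p: "p \<in> S"
  shows "curv_form u p = (\<Sum>k\<in>UNIV. u $ k * curv_form (axis k 1) p)"
  using linear_sum[OF linear_curv_form[OF p], of "\<lambda>k. (u $ k) *\<^sub>R axis k 1" UNIV]
    linear_scale[OF linear_curv_form[OF p]]
  by (simp add: vec_expansion)

text \<open>Contraction of the two parts of R^i_k with g: the multiple of the identity gives g(u,
  u), the part along y^i gives g(y, u), which is L_u by Euler.\<close>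

lemma flag_curvature_eq:
  assumes h: hamel and p: "p \<in> S"
  shows "flag_curvature F (fst p) (snd p) u =
    (curv_scalar p * dy u (dy u L) p + curv_form u p * dy u L p) /
    (f p * f p * dy u (dy u L) p - dy u L p * dy u L p)"
proof -
  obtain x y where xy: "p = (x, y)"
    by (cases p)
  note q = p[unfolded xy]
  let ?g = "fund_tensor F x y"
  have "(\<Sum>k\<in>UNIV. ?g $ i $ m * riemann_curv F x y $ i $ k * u $ k * u $ m) =
      curv_scalar p * (?g $ i $ m * u $ i * u $ m) + curv_form u p * (?g $ i $ m * y $ i * u $ m)" for i m
  proof -
    have "(\<Sum>k\<in>UNIV. ?g $ i $ m * riemann_curv F x y $ i $ k * u $ k * u $ m) =
        (\<Sum>k\<in>UNIV. (curv_scalar p * ?g $ i $ m * u $ m) * ((if i = k then 1 else 0) * u $ k)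
          + (?g $ i $ m * y $ i * u $ m) * (u $ k * curv_form (axis k 1) p))"
      using riemann_curv_entry[OF h p] by (intro sum.cong refl) (simp add: xy algebra_simps)
    also have "\<dots> = (curv_scalar p * ?g $ i $ m * u $ m) * (\<Sum>k\<in>UNIV. (if i = k then 1 else 0) * u $ k)
        + (?g $ i $ m * y $ i * u $ m) * curv_form u p"
      by (simp add: sum.distrib sum_distrib_left[symmetric] curv_form_expansion[OF p, of u])
    also have "(\<Sum>k\<in>UNIV. (if i = k then 1 else 0) * u $ k) = u $ i"
      by (simp add: if_distrib[of "\<lambda>z. z * _"] cong: if_cong)
    finally show ?thesis
      by (simp add: mult_ac)
  qed
  then have "(\<Sum>i\<in>UNIV. \<Sum>m\<in>UNIV. \<Sum>k\<in>UNIV. ?g $ i $ m * riemann_curv F x y $ i $ k * u $ k * u $ m) =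
      curv_scalar p * dy u (dy u L) p + curv_form u p * dy u (dy y L) p"
    by (simp add: sum.distrib sum_distrib_left[symmetric] fund_tensor_sum[OF q] xy)
  then show ?thesis
    using L_yy(2)[OF p, of u]
    by (simp add: flag_curvature_def Let_def fund_tensor_sum[OF q] xy f_def power2_eq_square)
qed

text \<open>Strict Cauchy-Schwarz for g, from g(u - s y, u - s y) > 0 where s y is the g-orthogonal
  projection of u on y and g(y, y) = F^2. It makes the denominator of the flag curvature
  positive.\<close>

lemma L_yy_gram_pos:
  assumes p: "p \<in> S" and u: "\<And>c. u \<noteq> c *\<^sub>R snd p"
  shows "dy u L p * dy u L p < f p * f p * dy u (dy u L) p"
proof -
  obtain x y where xy: "p = (x, y)"
    by (cases p)
  note q = p[unfolded xy]
  let ?g = "fund_tensor F x y"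
  have f0: "0 < f p"
    by (rule f_pos[OF p])
  have g: "v \<bullet> (?g *v w) = dy w (dy v L) p" for v w
    using fund_tensor_inner[OF q] by (simp add: xy)
  have gy: "y \<bullet> (?g *v u) = dy u L p" "u \<bullet> (?g *v y) = dy u L p" "y \<bullet> (?g *v y) = f p * f p"
    using L_yy[OF p, of u] L_yy(1)[OF p, of y] der_L[OF p, of "(0, y)"] dy_f_y[OF p]
    unfolding g by (simp_all add: xy)
  define s where "s = dy u L p / (f p * f p)"
  have "u - s *\<^sub>R y \<noteq> 0"
    using u[of s] by (simp add: xy)
  from L_yy_pos[OF p this] have "0 < (u - s *\<^sub>R y) \<bullet> (?g *v (u - s *\<^sub>R y))"
    by (simp add: g)
  also have "\<dots> = u \<bullet> (?g *v u) - 2 * s * dy u L p + s * s * (f p * f p)"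
    by (simp add: matrix_vector_mult_diff_distrib matrix_vector_mult_scaleR inner_diff_left inner_diff_right
        gy algebra_simps)
  also have "\<dots> = dy u (dy u L) p - dy u L p * dy u L p / (f p * f p)"
    using f0 by (simp add: g s_def field_simps)
  finally show ?thesis
    using f0 by (simp add: field_simps)
qed

text \<open>The scalar equation holds on the whole slit bundle and may therefore be differentiated
  in y. The result replaces the mixed derivative of \<open>P\<close> in \<open>curv_form\<close>,
  which then equals 3 P_x - 3 P P_y - 2 F F_y.\<close>

lemma dxy_P_deriv:
  assumes "\<And>p. p \<in> S \<Longrightarrow> dxy P p = P p * P p + f p * f p" and p: "p \<in> S"
  shows "dy u (dx (snd p) P) p + dx u P p = 2 * (P p * dy u P p + f p * dy u f p)"
proof -
  have "dy u (dxy P) p = dy u (\<lambda>p. P p * P p + f p * f p) p"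
    by (rule der_cong[OF open_S p assms(1)])
  also have "\<dots> = dy u (\<lambda>p. P p * P p) p + dy u (\<lambda>p. f p * f p) p"
    by (intro der_add diff[OF _ p] smooth_intros open_S)
  also have "\<dots> = 2 * (P p * dy u P p + f p * dy u f p)"
    using der_mult[OF diff[OF smooth_P p] diff[OF smooth_P p]]
      der_mult[OF diff[OF smooth_f p] diff[OF smooth_f p]] by simp
  finally show ?thesis
    by (simp add: dy_dxy[OF open_S smooth_P p])
qed

text \<open>Contraction with y gives P_{x^k} y^k = P^2 + F^2, so the scalar part is - F^2, and 3 P_x
  - 3 P P_y - 2 F F_y collapses to F F_y = L_y. Numerator and denominator of the flag curvature are
  then opposite.\<close>

lemma riccati_imp_flag_curvature:
  assumes h: hamel and r: riccati
  shows "has_flag_curvature U F (- 1)"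
  unfolding has_flag_curvature_def
proof (intro ballI allI impI)
  fix x y u :: "real^'n" assume x: "x \<in> U" and "dim (span {y, u}) = 2"
  then have y: "y \<noteq> 0" and u: "\<And>c. u \<noteq> c *\<^sub>R y"
    unfolding dim_span dim_pair_eq_2_iff by auto
  define p where "p = (x, y)"
  have p: "p \<in> S"
    using x y by (simp add: p_def)
  have X: "dxy P q = P q * P q + f q * f q" if "q \<in> S" for q
    using bspec[OF r[unfolded riccati_def] that] dy_P_y[OF that] dy_f_y[OF that] by (simp add: dxy_def)
  have "curv_scalar p = - (f p * f p)"
    by (simp add: curv_scalar_def X[OF p])
  moreover have "curv_form u p = dy u L p"
  proof -
    have "dx u P p = P p * dy u P p + f p * dy u f p"
      using bspec[OF r[unfolded riccati_def] p] by blast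
    then show ?thesis
      unfolding curv_form_def der_L[OF p] using dxy_P_deriv[of p u, OF X p]
      by (simp add: algebra_simps)
  qed
  moreover have "dy u L p * dy u L p < f p * f p * dy u (dy u L) p"
    using L_yy_gram_pos[OF p] u by (simp add: p_def)
  moreover have "(- c * a + b * b) / (c * a - b * b) = - 1" if "b * b < c * a" for a b c :: real
    using that by (simp add: divide_eq_eq)
  ultimately have "flag_curvature F (fst p) (snd p) u = - 1"
    unfolding flag_curvature_eq[OF h p] by simp
  then show "flag_curvature F x y u = - 1"
    by (simp add: p_def)
qed

text \<open>For u independent of y, K = -1 reads (scalar + F^2) g(u, u) + (form(u) - L_u) L_u = 0. A
  nonzero u with L_u = 0 yields the scalar; then every such u with L_u \<noteq> 0 yields form(u) =
  L_u. No flag tests the direction y itself, which is reached by linearity. Finally 3 P_x - 3 P P_y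
  - 2 F F_y = F F_y is solved for P_x.\<close>

lemma flag_curvature_imp_riccati:
  assumes n: "2 \<le> CARD('n)" and h: hamel and K: "has_flag_curvature U F (- 1)"
  shows riccati
proof -
  have K': "(curv_scalar p + f p * f p) * dy u (dy u L) p + (curv_form u p - dy u L p) * dy u L p = 0"
    if p: "p \<in> S" and u: "\<And>c. u \<noteq> c *\<^sub>R snd p" for p u
  proof -
    have "dim (span {snd p, u}) = 2"
      unfolding dim_span dim_pair_eq_2_iff using p u by (simp add: mem_Times_iff)
    then have "flag_curvature F (fst p) (snd p) u = - 1"
      using K p unfolding has_flag_curvature_def by (simp add: mem_Times_iff)
    moreover have "(c + e) * a + (b - d) * d = 0" if "(c * a + b * d) / (e * a - d * d) = - 1" "d * d < e * a"
      for a b c d e :: real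
      using that by (simp add: divide_eq_eq algebra_simps)
    ultimately show ?thesis
      using L_yy_gram_pos[OF p u] unfolding flag_curvature_eq[OF h p] by blast
  qed
  have form: "curv_scalar p = - (f p * f p) \<and> (\<forall>u. curv_form u p = dy u L p)" if p: "p \<in> S" for p
  proof -
    let ?y = "snd p"
    have lin: "linear (\<lambda>u. dy u L p)"
      by (rule linear_dy[OF diff[OF smooth_L p]])
    have f0: "0 < f p"
      by (rule f_pos[OF p])
    have Ly: "dy ?y L p = f p * f p"
      by (simp add: der_L[OF p] dy_f_y[OF p])
    have indep: "u \<noteq> c *\<^sub>R ?y" if "dy u L p = 0" "u \<noteq> 0" for u c
      using that f0 Ly linear_scale[OF lin, of c ?y] by auto
    \<comment> \<open>Dimension at least two provides a nonzero vector in the kernel of L_y. It is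
      no multiple of y, since L_y takes the value F^2 > 0 on y.\<close>
    obtain k where k: "k \<noteq> 0" "orthogonal (\<chi> i. dy (axis i 1) L p) k"
      using orthogonal_to_vector_exists[of "\<chi> i. dy (axis i 1) L p"] n by auto
    have Lk: "dy k L p = 0"
      using k(2) dy_expansion[OF diff[OF smooth_L p], of k]
      by (simp add: orthogonal_def inner_vec_def mult.commute)
    have "(curv_scalar p + f p * f p) * dy k (dy k L) p + (curv_form k p - dy k L p) * dy k L p = 0"
      by (rule K'[OF p]) (rule indep[OF Lk k(1)])
    then have scalar: "curv_scalar p = - (f p * f p)"
      using L_yy_pos[OF p k(1)] unfolding Lk by simp
    have form1: "curv_form u p = dy u L p" if "\<And>c. u \<noteq> c *\<^sub>R ?y" "dy u L p \<noteq> 0" for u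
    proof -
      have "(curv_scalar p + f p * f p) * dy u (dy u L) p + (curv_form u p - dy u L p) * dy u L p = 0"
        by (rule K'[OF p that(1)])
      then show ?thesis
        using that(2) by (simp add: scalar)
    qed
    have form2: "curv_form v p = 0 \<and> curv_form ?y p = f p * f p" if "dy v L p = 0" "v \<noteq> 0" for v
    proof -
      have "curv_form (?y + t *\<^sub>R v) p = f p * f p" if "t \<noteq> 0" for t
      proof -
        have *: "dy (?y + t *\<^sub>R v) L p = f p * f p"
          using Ly \<open>dy v L p = 0\<close> linear_add[OF lin, of ?y "t *\<^sub>R v"] linear_scale[OF lin, of t v] by simp
        have "?y + t *\<^sub>R v \<noteq> c *\<^sub>R ?y" for c
        proof
          assume "?y + t *\<^sub>R v = c *\<^sub>R ?y"
          then have eq: "t *\<^sub>R v = (c - 1) *\<^sub>R ?y"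
            by (simp add: algebra_simps)
          have "v = (1 / t) *\<^sub>R (t *\<^sub>R v)"
            using that by simp
          then have "v = ((c - 1) / t) *\<^sub>R ?y"
            unfolding eq by simp
          then show False
            using indep[OF \<open>dy v L p = 0\<close> \<open>v \<noteq> 0\<close>] by blast
        qed
        then show ?thesis
          using form1 * f0 by simp
      qed
      \<comment> \<open>Two points of the affine line y + t v carry the same value, so by linearity
        the form is 0 on v and F^2 on y.\<close>
      from this[of 1] this[of 2] show ?thesis
        using linear_add[OF linear_curv_form[OF p], of ?y v]
          linear_add[OF linear_curv_form[OF p], of ?y "2 *\<^sub>R v"]
          linear_scale[OF linear_curv_form[OF p], of 2 v] by simp
    qed
    have "curv_form u p = dy u L p" for u
    proof -
      \<comment> \<open>Splitting of u into a multiple of y and a vector in the kernel of L_y; the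
        coefficient is dictated by L_y(y) = F^2.\<close>
      define c where "c = dy u L p / (f p * f p)"
      define v where "v = u - c *\<^sub>R ?y"
      have "dy v L p = 0"
        using f0 Ly linear_diff[OF lin, of u "c *\<^sub>R ?y"] linear_scale[OF lin, of c ?y]
        by (simp add: v_def c_def)
      then have "curv_form v p = 0"
        using form2[of v] linear_0[OF linear_curv_form[OF p]] by (cases "v = 0") auto
      then have "curv_form u p = c * curv_form ?y p"
        using linear_diff[OF linear_curv_form[OF p], of u "c *\<^sub>R ?y"]
          linear_scale[OF linear_curv_form[OF p], of c ?y] by (simp add: v_def)
      then show ?thesis
        using form2[OF Lk k(1)] f0 by (simp add: c_def)
    qed
    then show ?thesis
      using scalar by blast
  qed
  have X: "dxy P p = P p * P p + f p * f p" if "p \<in> S" for p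
    using form[OF that] by (simp add: curv_scalar_def)
  have "dx u P p = P p * dy u P p + f p * dy u f p" if p: "p \<in> S" for p u
    using conjunct2[OF form[OF p], THEN spec, of u] dxy_P_deriv[of p u, OF X p]
    unfolding curv_form_def der_L[OF p] by (simp add: algebra_simps)
  then show ?thesis
    by (simp add: riccati_def)
qed

end

section \<open>Straight geodesics\<close>

text \<open>Test with the part b of w orthogonal to u: then b is orthogonal to w too, so b = 0. For
  u = 0 the quotient is 0 and b = w. Expressing parallelism through orthogonal vectors turns vector
  equations along a curve into scalar ones.\<close>

lemma parallel_if_orthogonal:
  fixes u w :: "'a::real_inner"
  assumes "\<And>b. b \<bullet> u = 0 \<Longrightarrow> b \<bullet> w = 0"
  shows "\<exists>a. w = a *\<^sub>R u"
proof -
  define b where "b = w - ((w \<bullet> u) / (u \<bullet> u)) *\<^sub>R u"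
  have "b \<bullet> u = 0"
    by (cases "u = 0") (simp_all add: b_def inner_diff_left)
  moreover from this have "b \<bullet> w = 0"
    by (rule assms)
  moreover have "b \<bullet> b = b \<bullet> w - ((w \<bullet> u) / (u \<bullet> u)) * (b \<bullet> u)"
    by (subst (2) b_def) (simp add: inner_diff_right)
  ultimately have "b \<bullet> b = 0"
    by simp
  then have "w = ((w \<bullet> u) / (u \<bullet> u)) *\<^sub>R u"
    by (simp add: b_def)
  then show ?thesis
    by blast
qed

lemma inner_deriv_zero:
  fixes h :: "real \<Rightarrow> 'a::real_inner"
  assumes "open I" "t \<in> I" "(h has_vector_derivative d) (at t)" "\<And>s. s \<in> I \<Longrightarrow> b \<bullet> h s = k"
  shows "b \<bullet> d = 0"
proof -
  have "((\<lambda>s. b \<bullet> h s) has_vector_derivative b \<bullet> d) (at t)"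
    by (rule bounded_linear.has_vector_derivative[OF bounded_linear_inner_right assms(3)])
  then have "((\<lambda>s. b \<bullet> h s) has_real_derivative b \<bullet> d) (at t)"
    by (simp only: has_real_derivative_iff_has_vector_derivative)
  then have "((\<lambda>s. k) has_real_derivative b \<bullet> d) (at t)"
    by (rule has_field_derivative_transform_within_open[OF _ assms(1,2,4)])
  then show ?thesis
    by (rule DERIV_unique) (rule DERIV_const)
qed

context finsler_space
begin

lemma continuous_on_S:
  assumes "smooth_on H S" "continuous_on X g" "g ` X \<subseteq> S"
  shows "continuous_on X (\<lambda>x. H (g x))"
  using continuous_on_compose2[OF smooth_on_continuous_on[OF assms(1)] assms(2,3)] .

text \<open>The second-order equation becomes the first-order system with field (y, - 2 G) on the
  slit bundle. The given point is reached at the midpoint, so that it lies inside an open interval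
  of two-sided differentiability.\<close>

lemma geodesic_exists:
  assumes p: "p \<in> S"
  obtains \<delta> c v where "0 < \<delta>" "c \<delta> = fst p" "v \<delta> = snd p"
    "\<And>t. t \<in> {0<..<2 * \<delta>} \<Longrightarrow> (c t, v t) \<in> S \<and> (c has_vector_derivative v t) (at t) \<and>
      (v has_vector_derivative - 2 *\<^sub>R geod_coeff F (c t) (v t)) (at t)"
proof -
  define G where "G = (\<lambda>p. geod_coeff F (fst p) (snd p))"
  define h where "h p = (snd p, - 2 *\<^sub>R G p)" for p
  obtain r K where r: "0 < r" "cball p r \<subseteq> S" "0 \<le> K"
    and K: "\<And>x z. x \<in> cball p r \<Longrightarrow> z \<in> cball p r \<Longrightarrow> norm (G x - G z) \<le> K * norm (x - z)"
    using smooth_on_local_Lipschitz[OF open_S smooth_geod_coeff p] unfolding G_def by blast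
  have hK: "norm (h x - h z) \<le> (1 + 2 * K) * norm (x - z)" if "x \<in> cball p r" "z \<in> cball p r" for x z
  proof -
    have "h x - h z = (snd (x - z), - 2 *\<^sub>R (G x - G z))"
      by (simp add: h_def algebra_simps)
    then have "norm (h x - h z) \<le> norm (snd (x - z)) + norm (- 2 *\<^sub>R (G x - G z))"
      by (simp only: norm_Pair_le)
    also have "\<dots> \<le> norm (x - z) + 2 * (K * norm (x - z))"
      using norm_snd_le[of "snd (x - z)" "fst (x - z)", unfolded prod.collapse] K[OF that] by (intro add_mono) simp_all
    finally show ?thesis
      by (simp add: algebra_simps)
  qed
  have "0 \<le> 1 + 2 * K"
    using r(3) by simp
  from picard_lindeloef[OF r(1) this hK] obtain \<delta> g where \<delta>: "0 < \<delta>" "g \<delta> = p"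
    and gb: "\<And>t. t \<in> {0..2 * \<delta>} \<Longrightarrow> g t \<in> cball p r"
    and g: "\<And>t. t \<in> {0..2 * \<delta>} \<Longrightarrow> (g has_vector_derivative h (g t)) (at t within {0..2 * \<delta>})"
    by blast
  show thesis
  proof (rule that[of \<delta> "\<lambda>t. fst (g t)" "\<lambda>t. snd (g t)"])
    fix t assume t: "t \<in> {0<..<2 * \<delta>}"
    then have t': "t \<in> {0..2 * \<delta>}"
      by auto
    have "at t within {0..2 * \<delta>} = at t"
      using t by (intro at_within_Icc_at) auto
    then have gt: "(g has_vector_derivative h (g t)) (at t)"
      using g[OF t'] by simp
    have "(fst (g t), snd (g t)) \<in> S"
      using gb[OF t'] r(2) by auto
    moreover have "((\<lambda>t. fst (g t)) has_vector_derivative fst (h (g t))) (at t)"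
      by (rule bounded_linear.has_vector_derivative[OF bounded_linear_fst gt])
    moreover have "((\<lambda>t. snd (g t)) has_vector_derivative snd (h (g t))) (at t)"
      by (rule bounded_linear.has_vector_derivative[OF bounded_linear_snd gt])
    ultimately show "(fst (g t), snd (g t)) \<in> S \<and>
        ((\<lambda>t. fst (g t)) has_vector_derivative snd (g t)) (at t) \<and>
        ((\<lambda>t. snd (g t)) has_vector_derivative - 2 *\<^sub>R geod_coeff F (fst (g t)) (snd (g t))) (at t)"
      by (simp add: h_def G_def)
  qed (simp_all add: \<delta>)
qed

text \<open>Take the geodesic with initial data p. For b orthogonal to its line, b . c is constant;
  two derivatives show that the velocity y and then G are multiples of the same u. As y \<noteq> 0,
  G is a multiple of y.\<close>

lemma projectively_flat_imp_hamel:
  assumes flat: "projectively_flat U F"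
  shows hamel
  unfolding hamel_iff
proof
  fix p assume p: "p \<in> S"
  obtain \<delta> c v where \<delta>: "0 < \<delta>" "c \<delta> = fst p" "v \<delta> = snd p"
    and cv: "\<And>t. t \<in> {0<..<2 * \<delta>} \<Longrightarrow> (c t, v t) \<in> S \<and> (c has_vector_derivative v t) (at t) \<and>
      (v has_vector_derivative - 2 *\<^sub>R geod_coeff F (c t) (v t)) (at t)"
    using geodesic_exists[OF p] by blast
  let ?I = "{0<..<2 * \<delta>}" and ?G = "geod_coeff F (fst p) (snd p)"
  have \<delta>I: "\<delta> \<in> ?I"
    using \<delta>(1) by simp
  have "geodesic U F ?I c"
    unfolding geodesic_def using cv by (auto simp: is_interval_convex_1 intro!: exI[of _ v])
  then have "collinear (c ` ?I)"
    using flat by (simp add: projectively_flat_def)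
  then obtain u where u: "\<And>x y. x \<in> c ` ?I \<Longrightarrow> y \<in> c ` ?I \<Longrightarrow> \<exists>k. x - y = k *\<^sub>R u"
    unfolding collinear_def by blast
  have bc: "b \<bullet> c s = b \<bullet> c \<delta>" if "b \<bullet> u = 0" "s \<in> ?I" for b s
  proof -
    obtain k where "c s - c \<delta> = k *\<^sub>R u"
      using u \<open>s \<in> ?I\<close> \<delta>I by blast
    then have "b \<bullet> (c s - c \<delta>) = 0"
      using that(1) by simp
    then show ?thesis
      by (simp add: inner_diff_right)
  qed
  have bv: "b \<bullet> v s = 0" if "b \<bullet> u = 0" "s \<in> ?I" for b s
    by (rule inner_deriv_zero[where h = c, OF open_greaterThanLessThan that(2)
          cv[OF that(2), THEN conjunct2, THEN conjunct1] bc[OF that(1)]])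
  have bG: "b \<bullet> ?G = 0" if "b \<bullet> u = 0" for b
  proof -
    have "b \<bullet> (- 2 *\<^sub>R ?G) = 0"
      by (rule inner_deriv_zero[where h = v, OF open_greaterThanLessThan \<delta>I
            cv[OF \<delta>I, THEN conjunct2, THEN conjunct2, unfolded \<delta>(2,3)] bv[OF that]])
    then show ?thesis
      by simp
  qed
  have "b \<bullet> snd p = 0" if "b \<bullet> u = 0" for b
    using bv[OF that \<delta>I] \<delta>(3) by simp
  then obtain a where a: "snd p = a *\<^sub>R u"
    using parallel_if_orthogonal by blast
  obtain a' where a': "?G = a' *\<^sub>R u"
    using parallel_if_orthogonal bG by blast
  have "a \<noteq> 0"
    using p a by auto
  then have "(a' / a) *\<^sub>R snd p = a' *\<^sub>R u"
    by (simp add: a)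
  then have "?G = (a' / a) *\<^sub>R snd p"
    by (simp only: a')
  then show "\<exists>k. ?G = k *\<^sub>R snd p"
    by blast
qed

text \<open>With G = P y the geodesic equation gives (b . v)' = - 2 P (b . v) for each constant b,
  so a component of the velocity that vanishes at one time vanishes always. Hence the velocity stays
  parallel to its value at \<open>t0\<close>.\<close>

lemma hamel_imp_projectively_flat:
  assumes h: hamel
  shows "projectively_flat U F"
  unfolding projectively_flat_def
proof (intro allI impI)
  fix I c assume "geodesic U F I c"
  then obtain v where I: "open I" "is_interval I" and cU: "c ` I \<subseteq> U"
    and v: "\<And>t. t \<in> I \<Longrightarrow> (c has_vector_derivative v t) (at t) \<and> v t \<noteq> 0 \<and>
        (v has_vector_derivative - 2 *\<^sub>R geod_coeff F (c t) (v t)) (at t)"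
    unfolding geodesic_def by blast
  have S: "(c t, v t) \<in> S" if "t \<in> I" for t
    using v[OF that] cU that by auto
  show "collinear (c ` I)"
  proof (cases "I = {}")
    case False
    then obtain t0 where t0: "t0 \<in> I"
      by blast
    have bv: "b \<bullet> v t = 0" if b: "b \<bullet> v t0 = 0" and t: "t \<in> I" for b t
    proof -
      \<comment> \<open>\<open>linear_ode_zero\<close> works on a compact interval containing both
        times, and \<open>t\<close> may lie on either side of \<open>t0\<close>.\<close>
      define J where "J = {min t0 t..max t0 t}"
      have "min t0 t \<in> I" "max t0 t \<in> I"
        using t t0 by (simp_all add: min_def max_def)
      then have "s \<in> I" if "s \<in> J" for s
        using mem_is_interval_1_I[OF I(2), of "min t0 t" "max t0 t" s] that by (simp add: J_def)
      then have J: "J \<subseteq> I"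
        by (rule subsetI)
      have "isCont c s" "isCont v s" if "s \<in> J" for s
        using v[of s] J that has_vector_derivative_continuous[of c _ s UNIV]
          has_vector_derivative_continuous[of v _ s UNIV] by blast+
      then have "continuous_on J c" "continuous_on J v"
        by (simp_all add: continuous_at_imp_continuous_on)
      then have "continuous_on J (\<lambda>t. (c t, v t))"
        by (rule continuous_on_Pair)
      moreover have "(\<lambda>t. (c t, v t)) ` J \<subseteq> S"
        using S J by blast
      ultimately have "continuous_on J (\<lambda>t. P (c t, v t))"
        by (rule continuous_on_S[OF smooth_P])
      then have cont: "continuous_on J (\<lambda>t. - 2 * P (c t, v t))"
        by (intro continuous_intros)
      show ?thesis
      proof (rule linear_ode_zero[of "min t0 t" "max t0 t" "\<lambda>t. b \<bullet> v t" "\<lambda>t. - 2 * P (c t, v t)" t0])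
        fix s assume "s \<in> {min t0 t..max t0 t}"
        then have s: "s \<in> I"
          using J by (auto simp: J_def)
        have "(v has_vector_derivative - 2 *\<^sub>R (P (c s, v s) *\<^sub>R v s)) (at s)"
          using v[OF s] hamel_geod_coeff[OF h S[OF s]] by simp
        then have "((\<lambda>t. b \<bullet> v t) has_vector_derivative b \<bullet> (- 2 *\<^sub>R (P (c s, v s) *\<^sub>R v s))) (at s)"
          by (rule bounded_linear.has_vector_derivative[OF bounded_linear_inner_right])
        then have "((\<lambda>t. b \<bullet> v t) has_real_derivative - 2 * P (c s, v s) * (b \<bullet> v s)) (at s)"
          by (simp add: has_real_derivative_iff_has_vector_derivative)
        then show "((\<lambda>t. b \<bullet> v t) has_real_derivative - 2 * P (c s, v s) * (b \<bullet> v s))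
            (at s within {min t0 t..max t0 t})"
          by (rule has_field_derivative_at_within)
      qed (use b cont J_def in auto)
    qed
    have bc: "b \<bullet> c t = b \<bullet> c t0" if b: "b \<bullet> v t0 = 0" and t: "t \<in> I" for b t
    proof -
      have "((\<lambda>t. b \<bullet> c t) has_real_derivative 0) (at s within I)" if s: "s \<in> I" for s
      proof -
        have "(c has_vector_derivative v s) (at s)"
          using v[OF s] by blast
        then have "((\<lambda>t. b \<bullet> c t) has_vector_derivative b \<bullet> v s) (at s)"
          by (rule bounded_linear.has_vector_derivative[OF bounded_linear_inner_right])
        then have "((\<lambda>t. b \<bullet> c t) has_real_derivative 0) (at s)"
          using bv[OF b s] by (simp add: has_real_derivative_iff_has_vector_derivative)
        then show ?thesis
          by (rule has_field_derivative_at_within)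
      qed
      moreover have "convex I"
        using I(2) by (simp add: is_interval_convex)
      ultimately obtain k where "\<And>s. s \<in> I \<Longrightarrow> b \<bullet> c s = k"
        using has_field_derivative_zero_constant[of I "\<lambda>t. b \<bullet> c t"] by blast
      then show ?thesis
        using t t0 by simp
    qed
    have "\<exists>k. c s - c t = k *\<^sub>R v t0" if "s \<in> I" "t \<in> I" for s t
      by (rule parallel_if_orthogonal) (simp add: inner_diff_right bc that)
    then show ?thesis
      unfolding collinear_def by blast
  qed simp
qed

lemma projectively_flat_curvature_iff:
  assumes "2 \<le> CARD('n)"
  shows "projectively_flat U F \<and> has_flag_curvature U F (- 1) \<longleftrightarrow> hamel \<and> riccati"
  using projectively_flat_imp_hamel hamel_imp_projectively_flat
    flag_curvature_imp_riccati[OF assms] riccati_imp_flag_curvature by blast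

section \<open>The implicit representation\<close>

text \<open>The difference of the two sides is a function of \<open>x\<close> that solves a linear homogeneous
  first-order equation on the set where the second argument avoids \<open>0\<close>; that set is \<open>U\<close> or \<open>U\<close>
  without a point, hence connected.\<close>

lemma burgers_constant:
  assumes n: "2 \<le> CARD('n)" and U: "connected U"
    and \<Phi>: "smooth_on \<Phi> S" and b: "\<And>p u. p \<in> S \<Longrightarrow> dx u \<Phi> p = \<Phi> p * dy u \<Phi> p"
    and p0: "(x0, y0) \<in> S" and x: "x \<in> U" "y0 + \<Phi> (x0, y0) *\<^sub>R (x0 - x) \<noteq> 0"
  shows "\<Phi> (x, y0 + \<Phi> (x0, y0) *\<^sub>R (x0 - x)) = \<Phi> (x0, y0)"
proof -
  define c where "c = \<Phi> (x0, y0)"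
  define Y where "Y x = y0 + c *\<^sub>R (x0 - x)" for x
  define V where "V = {x \<in> U. Y x \<noteq> 0}"
  have V: "V = U \<or> (\<exists>z. V = U - {z})"
  proof (cases "c = 0")
    case True
    then show ?thesis
      using p0 by (auto simp: V_def Y_def)
  next
    case False
    have "Y x = 0 \<longleftrightarrow> x = x0 + (1 / c) *\<^sub>R y0" for x
    proof -
      have "Y x = c *\<^sub>R (x0 + (1 / c) *\<^sub>R y0 - x)"
        using False by (simp add: Y_def algebra_simps)
      then show ?thesis
        using False by auto
    qed
    then have "V = U - {x0 + (1 / c) *\<^sub>R y0}"
      by (auto simp: V_def)
    then show ?thesis
      by blast
  qed
  have oV: "open V"
    using V open_U open_delete[OF open_U] by metis
  have "connected (U - {z})" for z
    using connected_open_delete[OF open_U U] n by simp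
  then have cV: "connected V"
    using V U by metis
  have YS: "(x, Y x) \<in> S" if "x \<in> V" for x
    using that by (simp add: V_def)
  have Y': "((\<lambda>x. (x, Y x)) has_derivative (\<lambda>u. (u, - c *\<^sub>R u))) (at x)" for x
    unfolding Y_def by (auto intro!: derivative_eq_intros simp: algebra_simps)
  have D: "((\<lambda>x. \<Phi> (x, Y x) - c) has_derivative (\<lambda>u. dy u \<Phi> (x, Y x) * (\<Phi> (x, Y x) - c))) (at x)"
    if "x \<in> V" for x
  proof -
    note d = diff[OF \<Phi> YS[OF that]]
    have "((\<lambda>x. \<Phi> (x, Y x) - c) has_derivative (\<lambda>u. der (u, - c *\<^sub>R u) \<Phi> (x, Y x) - 0)) (at x)"
      by (rule has_derivative_diff[OF has_derivative_compose[OF Y' has_derivative_der[OF d]] has_derivative_const])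
    \<comment> \<open>On the sheet y moves by - c u when x moves by u; the equation for
      \<open>\<Phi>\<close> turns \<Phi>_x - c \<Phi>_y into (\<Phi> - c) \<Phi>_y.\<close>
    moreover have "der (u, - c *\<^sub>R u) \<Phi> (x, Y x) - 0 = dy u \<Phi> (x, Y x) * (\<Phi> (x, Y x) - c)" for u
      using linear_scale[OF linear_dy[OF d], of "- c" u] unfolding der_pair[OF d, of u "- c *\<^sub>R u"] b[OF YS[OF that]]
      by (simp add: algebra_simps)
    ultimately show ?thesis
      by (simp only:)
  qed
  have A: "continuous_on V (\<lambda>x. dy u \<Phi> (x, Y x))" for u
  proof (rule continuous_on_S[OF smooth_on_der[OF \<Phi>]])
    show "continuous_on V (\<lambda>x. (x, Y x))"
      unfolding Y_def by (intro continuous_intros)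
    show "(\<lambda>x. (x, Y x)) ` V \<subseteq> S"
      using YS by blast
  qed
  have x0: "x0 \<in> V" "\<Phi> (x0, Y x0) - c = 0"
    using p0 by (simp_all add: V_def Y_def c_def)
  have "x \<in> V"
    using x by (simp add: V_def Y_def c_def)
  have "\<Phi> (x, Y x) - c = 0"
    by (rule linear_pde_zero[of V "\<lambda>x. \<Phi> (x, Y x) - c" "\<lambda>x u. dy u \<Phi> (x, Y x)" x0 x,
          OF oV cV D A x0 \<open>x \<in> V\<close>])
  then show ?thesis
    by (simp add: Y_def c_def)
qed

text \<open>Setting x = 0 in \<open>burgers_constant\<close> gives the second claim once the sheet
  avoids y = 0 there. Otherwise y0 = - c x0, the sheet lies at \<epsilon> y0 over \<epsilon> x0, and
  homogeneity together with continuity at x = 0 forces c = 0, hence y0 = 0.\<close>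

lemma burgers_implicit:
  assumes n: "2 \<le> CARD('n)" and U: "connected U" "0 \<in> U"
    and \<Phi>: "smooth_on \<Phi> S" and b: "\<And>p u. p \<in> S \<Longrightarrow> dx u \<Phi> p = \<Phi> p * dy u \<Phi> p"
    and hom: "homogeneous_on U 1 \<Phi>" and p0: "(x0, y0) \<in> S"
  shows "y0 + \<Phi> (x0, y0) *\<^sub>R x0 \<noteq> 0"
    and "\<Phi> (0, y0 + \<Phi> (x0, y0) *\<^sub>R x0) = \<Phi> (x0, y0)"
proof -
  have const: "\<Phi> (x, y0 + \<Phi> (x0, y0) *\<^sub>R (x0 - x)) = \<Phi> (x0, y0)"
    if "x \<in> U" "y0 + \<Phi> (x0, y0) *\<^sub>R (x0 - x) \<noteq> 0" for x
    by (rule burgers_constant[OF n U(1) \<Phi> _ p0 that]) (rule b)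
  show nz: "y0 + \<Phi> (x0, y0) *\<^sub>R x0 \<noteq> 0"
  proof
    define c where "c = \<Phi> (x0, y0)"
    assume "y0 + \<Phi> (x0, y0) *\<^sub>R x0 = 0"
    then have y0: "y0 = - c *\<^sub>R x0"
      by (simp add: c_def eq_neg_iff_add_eq_0)
    then have "c \<noteq> 0" "x0 \<noteq> 0" "y0 \<noteq> 0"
      using p0 by auto
    text \<open>Along \<open>x = \<epsilon> x0\<close> the constant value \<open>c\<close> is \<open>\<epsilon> \<Phi>(\<epsilon> x0, y0)\<close>, which tends to \<open>0\<close>.\<close>
    have eq: "\<epsilon> * \<Phi> (\<epsilon> *\<^sub>R x0, y0) = c" if "0 < \<epsilon>" "\<epsilon> *\<^sub>R x0 \<in> U" for \<epsilon>
    proof -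
      have "y0 + c *\<^sub>R (x0 - \<epsilon> *\<^sub>R x0) = \<epsilon> *\<^sub>R y0"
        by (simp add: y0 algebra_simps)
      then have "\<Phi> (\<epsilon> *\<^sub>R x0, \<epsilon> *\<^sub>R y0) = c"
        using const[OF that(2)] that(1) \<open>y0 \<noteq> 0\<close> by (simp add: c_def)
      then show ?thesis
        using homogeneous_onD[OF hom that(2) \<open>y0 \<noteq> 0\<close> that(1)] by simp
    qed
    have "isCont (\<lambda>\<epsilon>. (\<epsilon> *\<^sub>R x0, y0)) (0::real)"
      by (intro continuous_intros)
    moreover have "isCont \<Phi> (0 *\<^sub>R x0, y0)"
      using smooth_on_continuous_on[OF \<Phi>] open_S U(2) \<open>y0 \<noteq> 0\<close>
      by (simp add: continuous_on_eq_continuous_at)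
    ultimately have "isCont (\<lambda>\<epsilon>. \<Phi> (\<epsilon> *\<^sub>R x0, y0)) 0"
      by (rule isCont_o2)
    then have "isCont (\<lambda>\<epsilon>. \<epsilon> * \<Phi> (\<epsilon> *\<^sub>R x0, y0)) 0"
      by (intro isCont_mult continuous_ident)
    then have "((\<lambda>\<epsilon>. \<epsilon> * \<Phi> (\<epsilon> *\<^sub>R x0, y0)) \<longlongrightarrow> 0) (at_right 0)"
      by (simp add: isCont_def filterlim_at_split)
    moreover have "\<forall>\<^sub>F \<epsilon> in at_right 0. \<epsilon> * \<Phi> (\<epsilon> *\<^sub>R x0, y0) = c"
    proof -
      have "((\<lambda>\<epsilon>. \<epsilon> *\<^sub>R x0) \<longlongrightarrow> 0 *\<^sub>R x0) (at_right (0::real))"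
        by (intro tendsto_intros)
      then have "\<forall>\<^sub>F \<epsilon> in at_right (0::real). \<epsilon> *\<^sub>R x0 \<in> U"
        using topological_tendstoD open_U U(2) by force
      moreover have "\<forall>\<^sub>F \<epsilon> in at_right (0::real). 0 < \<epsilon>"
        by (simp add: eventually_at_right_less)
      ultimately show ?thesis
        by eventually_elim (rule eq)
    qed
    ultimately have "((\<lambda>\<epsilon>::real. c) \<longlongrightarrow> 0) (at_right 0)"
      by (rule Lim_transform_eventually)
    then show False
      using \<open>c \<noteq> 0\<close> by (simp add: tendsto_const_iff)
  qed
  show "\<Phi> (0, y0 + \<Phi> (x0, y0) *\<^sub>R x0) = \<Phi> (x0, y0)"
    using const[OF U(2)] nz by simp
qed

text \<open>Differentiation gives (1 - h'(x)) \<Phi>_x = \<Phi> h' and (1 - h'(x)) \<Phi>_y = h' as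
  forms in u, and the common factor cancels. The argument of \<open>h\<close> never vanishes: if it
  did, \<Phi> = h(0) = 0 and hence y = 0.\<close>

lemma implicit_burgers:
  fixes h :: "real^'n \<Rightarrow> real"
  assumes \<Phi>: "smooth_on \<Phi> S" and h: "\<And>y. y \<noteq> 0 \<Longrightarrow> h differentiable (at y)" "h 0 = 0"
    and eq: "\<And>p. p \<in> S \<Longrightarrow> \<Phi> p = h (snd p + \<Phi> p *\<^sub>R fst p)" and p: "p \<in> S"
  shows "dx u \<Phi> p = \<Phi> p * dy u \<Phi> p"
proof -
  define w where "w = snd p + \<Phi> p *\<^sub>R fst p"
  have "w \<noteq> 0"
  proof
    assume "w = 0"
    then have "\<Phi> p = 0"
      using eq[OF p] h(2) by (simp add: w_def)
    then show False
      using \<open>w = 0\<close> p by (auto simp: w_def)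
  qed
  define h' where "h' = frechet_derivative h (at w)"
  have h': "(h has_derivative h') (at w)"
    using h(1)[OF \<open>w \<noteq> 0\<close>] by (simp add: h'_def frechet_derivative_works)
  note lin = has_derivative_linear[OF h']
  have W: "((\<lambda>q. snd q + \<Phi> q *\<^sub>R fst q) has_derivative
      (\<lambda>v. snd v + (\<Phi> p *\<^sub>R fst v + der v \<Phi> p *\<^sub>R fst p))) (at p)"
    by (intro has_derivative_add has_derivative_scaleR has_derivative_snd has_derivative_fst
        has_derivative_ident has_derivative_der diff[OF \<Phi> p])
  have D: "der v \<Phi> p = h' (snd v) + \<Phi> p * h' (fst v) + der v \<Phi> p * h' (fst p)" for v
  proof -
    have "der v \<Phi> p = der v (\<lambda>q. h (snd q + \<Phi> q *\<^sub>R fst q)) p"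
      by (rule der_cong[OF open_S p eq])
    also have "\<dots> = h' (snd v + (\<Phi> p *\<^sub>R fst v + der v \<Phi> p *\<^sub>R fst p))"
      by (rule der_eqI[OF has_derivative_compose[OF W h'[unfolded w_def]]])
    finally show ?thesis
      by (simp add: linear_add[OF lin] linear_scale[OF lin])
  qed
  define k where "k = 1 - h' (fst p)"
  have x: "dx u \<Phi> p * k = \<Phi> p * h' u" and y: "dy u \<Phi> p * k = h' u" for u
    using D[of "(u, 0)"] D[of "(0, u)"] linear_0[OF lin] by (simp_all add: k_def algebra_simps)
  \<comment> \<open>If k = 0, the equation for \<Phi>_y gives h' = 0, in particular h'(x) = 0, and
    so k = 1.\<close>
  have "k \<noteq> 0"
    using y[of "fst p"] by (auto simp: k_def)
  moreover have "dx u \<Phi> p * k = \<Phi> p * dy u \<Phi> p * k"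
    using x[of u] y[of u] by simp
  ultimately show ?thesis
    by simp
qed

text \<open>\<open>Q(x, ty)/t - Q(x, y)\<close> solves a linear homogeneous equation in \<open>x\<close>: its \<open>y\<close>-derivative, which
  the second equation brings in, is eliminated by the first one and the homogeneity of \<open>f\<close>.\<close>

lemma burgers_homogeneous:
  assumes U: "connected U" "0 \<in> U" and Q: "smooth_on Q S"
    and fx: "\<And>p a. p \<in> S \<Longrightarrow> dx a f p = Q p * dy a f p + dy a Q p * f p"
    and Qx: "\<And>p a. p \<in> S \<Longrightarrow> dx a Q p = Q p * dy a Q p + f p * dy a f p"
    and hom0: "\<And>y t. y \<noteq> 0 \<Longrightarrow> 0 < t \<Longrightarrow> Q (0, t *\<^sub>R y) = t * Q (0, y)"
  shows "homogeneous_on U 1 Q"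
  unfolding homogeneous_on_def
proof (intro ballI allI impI)
  fix x y :: "real^'n" and t :: real
  assume x: "x \<in> U" and y: "y \<noteq> 0" and t: "0 < t"
  have S: "(z, y) \<in> S" "(z, t *\<^sub>R y) \<in> S" if "z \<in> U" for z
    using that y t by simp_all
  define D where "D z = (1 / t) * Q (z, t *\<^sub>R y) - Q (z, y)" for z
  define A where "A z a = dy a Q (z, t *\<^sub>R y) - Q (z, y) * dy a f (z, y) / f (z, y)" for z a
  have D': "(D has_derivative (\<lambda>a. A z a * D z)) (at z)" if z: "z \<in> U" for z
  proof -
    have i: "((\<lambda>z. (z, v)) has_derivative (\<lambda>a. (a, 0))) (at z)" for v :: "real^'n"
      by (intro has_derivative_Pair has_derivative_ident has_derivative_const)
    have "(D has_derivative (\<lambda>a. (1 / t) * dx a Q (z, t *\<^sub>R y) - dx a Q (z, y))) (at z)"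
      unfolding D_def
      by (intro has_derivative_diff has_derivative_mult_right
          has_derivative_compose[OF i has_derivative_der[OF diff[OF Q S(1)[OF z]]]]
          has_derivative_compose[OF i has_derivative_der[OF diff[OF Q S(2)[OF z]]]])
    moreover have "(1 / t) * dx a Q (z, t *\<^sub>R y) - dx a Q (z, y) = A z a * D z" for a
    proof -
      define e g q q' r s where "e = f (z, y)" and "g = dy a f (z, y)" and "q = Q (z, y)"
        and "q' = Q (z, t *\<^sub>R y) / t" and "r = dy a Q (z, y)" and "s = dy a Q (z, t *\<^sub>R y)"
      have e: "0 < e"
        unfolding e_def by (rule f_pos[OF S(1)[OF z]])
      have f1: "f (z, t *\<^sub>R y) = t * e"
        using homogeneous_onD[OF homogeneous_f z y t] by (simp add: e_def)
      have f2: "dy a f (z, t *\<^sub>R y) = g"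
        using homogeneous_onD[OF homogeneous_on_dy[OF open_U smooth_f, of 0] z y t] homogeneous_f
        by (simp add: g_def)
      have f3: "dx a f (z, t *\<^sub>R y) = t * dx a f (z, y)"
        using homogeneous_onD[OF homogeneous_on_dx[OF open_U smooth_f homogeneous_f] z y t] by simp
      have q': "Q (z, t *\<^sub>R y) = t * q'"
        using t by (simp add: q'_def)
      \<comment> \<open>Both sides are the x-derivative of f at (z, t y): by \<open>fx\<close> at
        that point, and as t times \<open>fx\<close> at (z, y).\<close>
      have "t * (q' * g + s * e) = t * (q * g + r * e)"
        using fx[OF S(1)[OF z], of a] fx[OF S(2)[OF z], of a]
        unfolding f1 f2 f3 q' e_def[symmetric] g_def[symmetric] q_def[symmetric] r_def[symmetric] s_def[symmetric]
        by (simp add: algebra_simps)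
      then have rs: "q' * g + s * e = q * g + r * e"
        using t by simp
      have "(1 / t) * dx a Q (z, t *\<^sub>R y) - dx a Q (z, y) = (q' * s + e * g) - (q * r + e * g)"
        unfolding Qx[OF S(1)[OF z]] Qx[OF S(2)[OF z]]
        unfolding f1 f2 q' e_def[symmetric] g_def[symmetric] q_def[symmetric] r_def[symmetric] s_def[symmetric]
        using t by (simp add: algebra_simps)
      also have "\<dots> = (s - q * g / e) * (q' - q)"
      proof -
        \<comment> \<open>Substituting r e = q' g + s e - q g from \<open>rs\<close> makes the
          factor q' - q appear.\<close>
        have "e * ((q' * s + e * g) - (q * r + e * g)) = (s * e - q * g) * (q' - q)"
          using rs by algebra
        then show ?thesis
          using e by (simp add: field_simps)
      qed
      also have "\<dots> = A z a * D z"
        by (simp add: A_def D_def e_def g_def q_def q'_def s_def)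
      finally show ?thesis .
    qed
    ultimately show ?thesis
      by (simp only:)
  qed
  have A': "continuous_on U (\<lambda>z. A z a)" for a
  proof -
    have c: "continuous_on U (\<lambda>z. H (z, v))" if "smooth_on H S" "v \<noteq> 0" for H v
      by (rule continuous_on_S[OF that(1)]) (use that(2) in \<open>auto intro: continuous_intros\<close>)
    have "continuous_on U (\<lambda>z. dy a Q (z, t *\<^sub>R y))" "continuous_on U (\<lambda>z. Q (z, y))"
      "continuous_on U (\<lambda>z. dy a f (z, y))" "continuous_on U (\<lambda>z. f (z, y))"
      using y t by (auto intro!: c smooth_on_der Q smooth_f)
    moreover have "f (z, y) \<noteq> 0" if "z \<in> U" for z
      using f_pos[OF S(1)[OF that]] by simp
    ultimately show ?thesis
      unfolding A_def by (intro continuous_on_diff continuous_on_divide continuous_on_mult) auto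
  qed
  have D0: "D 0 = 0"
    using hom0[OF y t] t by (simp add: D_def)
  have "D x = 0"
    by (rule linear_pde_zero[of U D A 0 x, OF open_U U(1) D' A' U(2) D0 x])
  then show "Q (x, t *\<^sub>R y) = t ^ 1 * Q (x, y)"
    using t by (simp add: D_def field_simps)
qed

section \<open>The Hamel and Riccati equations versus the implicit representation\<close>

lemma der_mult_f:
  assumes "smooth_on Q S" "p \<in> S"
  shows "der v (\<lambda>p. Q p * f p) p = Q p * der v f p + der v Q p * f p"
  by (rule der_mult[OF diff[OF assms] diff[OF smooth_f assms(2)]])

text \<open>At y = 0 the projective factor is the quotient 0 / 0, which is 0. These values matter
  because the implicit equations are demanded at every y, zero included.\<close>

lemma F_proj_factor_vanish [simp]: "x \<in> U \<Longrightarrow> F x 0 = 0" "x \<in> U \<Longrightarrow> proj_factor F x 0 = 0"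
  using minkowski[of x] by (simp_all add: minkowski_norm_def proj_factor_def)

text \<open>The sign \<open>\<sigma>\<close> treats both solutions at once. Adding
  \<open>\<sigma>\<close> times Hamel's equation to the equation for P_x gives Phi_x = Phi Phi_y,
  because F F_y = (\<sigma> F) (\<sigma> F)_y.\<close>

lemma implicit_solution:
  assumes n: "2 \<le> CARD('n)" and U: "connected U" "0 \<in> U" and h: hamel and r: riccati
    and \<sigma>: "\<sigma> * \<sigma> = 1" and x: "x \<in> U"
  defines "\<Phi> \<equiv> \<lambda>x y. proj_factor F x y + \<sigma> * F x y"
  shows "\<Phi> x y = \<Phi> 0 (y + \<Phi> x y *\<^sub>R x)"
proof (cases "y = 0")
  case True
  then show ?thesis
    using x U(2) by (simp add: \<Phi>_def)
next
  case False
  let ?\<Phi> = "\<lambda>p. P p + \<sigma> * f p"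
  have \<Phi>: "\<Phi> x y = ?\<Phi> (x, y)" if "x \<in> U" "y \<noteq> 0" for x y
    using proj_factor_eq[of x y] that by (simp add: \<Phi>_def f_def)
  have smooth: "smooth_on ?\<Phi> S"
    by (intro smooth_intros open_S)
  have der: "der v ?\<Phi> p = der v P p + \<sigma> * der v f p" if p: "p \<in> S" for v p
    using der_add[OF diff[OF smooth_P p] diff[OF smooth_on_mult[OF open_S smooth_on_const[OF open_S] smooth_f] p]]
      der_cmult[OF diff[OF smooth_f p]] by simp
  have burgers: "dx u ?\<Phi> p = ?\<Phi> p * dy u ?\<Phi> p" if p: "p \<in> S" for u p
  proof -
    have "dx u P p = P p * dy u P p + f p * dy u f p"
      using bspec[OF r[unfolded riccati_def] p] by blast
    moreover have "dx u f p = P p * dy u f p + dy u P p * f p"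
      using bspec[OF h[unfolded hamel_def] p] der_mult_f[OF smooth_P p] by simp
    moreover have "\<sigma> * f p * (\<sigma> * dy u f p) = (\<sigma> * \<sigma>) * (f p * dy u f p)"
      by simp
    ultimately show ?thesis
      unfolding der[OF p] \<sigma> by (simp add: algebra_simps)
  qed
  have hom: "homogeneous_on U 1 ?\<Phi>"
    using homogeneous_P homogeneous_f unfolding homogeneous_on_def by (simp add: algebra_simps)
  have "(x, y) \<in> S"
    using x False by simp
  then have "y + ?\<Phi> (x, y) *\<^sub>R x \<noteq> 0" "?\<Phi> (0, y + ?\<Phi> (x, y) *\<^sub>R x) = ?\<Phi> (x, y)"
    using burgers_implicit[OF n U smooth _ hom] burgers by blast+
  then show ?thesis
    using \<Phi>[OF x False] \<Phi>[OF U(2)] by simp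
qed

lemma implicit_representation_exists:
  assumes n: "2 \<le> CARD('n)" and U: "connected U" "0 \<in> U" and h: hamel and r: riccati
  shows "implicit_representation U F (F 0) (proj_factor F 0)
    (\<lambda>x y. proj_factor F x y + F x y) (\<lambda>x y. proj_factor F x y - F x y)"
  unfolding implicit_representation_def
proof (intro conjI ballI allI)
  show "minkowski_norm (F 0)"
    by (rule minkowski[OF U(2)])
  show "pos_homogeneous (proj_factor F 0)"
    unfolding pos_homogeneous_def
  proof (intro allI impI)
    fix y :: "real^'n" and c :: real assume c: "0 < c"
    show "proj_factor F 0 (c *\<^sub>R y) = c * proj_factor F 0 y"
    proof (cases "y = 0")
      case False
      then have "(0, y) \<in> S" "(0, c *\<^sub>R y) \<in> S"
        using c U(2) by simp_all
      then show ?thesis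
        using homogeneous_onD[OF homogeneous_P U(2) False c] by (simp only: proj_factor_eq power_one_right)
    qed (use U(2) in simp)
  qed
  have "smooth_on (\<lambda>y. P ((0, 0) + (0, y))) (- {0})"
    by (rule smooth_on_compose_affine[OF _ bounded_linear_Pair[OF bounded_linear_zero bounded_linear_ident] _ smooth_P])
      (use U(2) in auto)
  then show "smooth_on (proj_factor F 0) (- {0})"
    by (rule smooth_on_transform[rotated]) (use U(2) in \<open>auto simp: proj_factor_eq\<close>)
  have "smooth_on (\<lambda>p. P p + f p) S" "smooth_on (\<lambda>p. P p - f p) S"
    by (intro smooth_intros open_S)+
  moreover have "(\<lambda>(x, y). proj_factor F x y + F x y) p = P p + f p"
    "(\<lambda>(x, y). proj_factor F x y - F x y) p = P p - f p" if "p \<in> S" for p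
    using proj_factor_eq[of "fst p" "snd p"] that by (simp_all add: f_def case_prod_unfold)
  ultimately show "smooth_on (\<lambda>(x, y). proj_factor F x y + F x y) S"
    "smooth_on (\<lambda>(x, y). proj_factor F x y - F x y) S"
    using smooth_on_transform[OF open_S, of "\<lambda>p. P p + f p" "\<lambda>(x, y). proj_factor F x y + F x y"]
      smooth_on_transform[OF open_S, of "\<lambda>p. P p - f p" "\<lambda>(x, y). proj_factor F x y - F x y"]
    by simp_all
next
  fix x y assume x: "x \<in> U"
  show "proj_factor F x y + F x y = proj_factor F 0 (y + (proj_factor F x y + F x y) *\<^sub>R x)
      + F 0 (y + (proj_factor F x y + F x y) *\<^sub>R x)"
    using implicit_solution[OF n U h r, of 1 x y] x by simp
  show "proj_factor F x y - F x y = proj_factor F 0 (y + (proj_factor F x y - F x y) *\<^sub>R x)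
      - F 0 (y + (proj_factor F x y - F x y) *\<^sub>R x)"
    using implicit_solution[OF n U h r, of "- 1" x y] x by simp
qed simp

text \<open>Half the difference of the two solutions is F, half their sum is \<open>Q\<close>.
  Subtracting and adding their equations Phi_x = Phi Phi_y gives \<open>hamel\<close> and
  \<open>riccati\<close> with \<open>Q\<close> in place of \<open>P\<close>. At x = 0 the implicit
  equations are explicit, so Q(0, y) = \<phi>(y) is homogeneous; this spreads over \<open>U\<close>,
  and \<open>hamel_unique\<close> identifies \<open>Q\<close> with \<open>P\<close>.\<close>

lemma implicit_representation_imp:
  assumes U: "connected U" "0 \<in> U" and rep: "implicit_representation U F \<psi> \<phi> Pp Pm"
  shows "hamel \<and> riccati \<and> (\<forall>y. \<psi> y = F 0 y) \<and> (\<forall>y. y \<noteq> 0 \<longrightarrow> \<phi> y = proj_factor F 0 y)"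
proof -
  have \<psi>: "minkowski_norm \<psi>" and \<phi>: "pos_homogeneous \<phi>" "smooth_on \<phi> (- {0})"
    and sp: "smooth_on (\<lambda>(x, y). Pp x y) S" and sm: "smooth_on (\<lambda>(x, y). Pm x y) S"
    and F: "\<And>x y. x \<in> U \<Longrightarrow> F x y = 1/2 * (Pp x y - Pm x y)"
    and Pp: "\<And>x y. x \<in> U \<Longrightarrow> Pp x y = \<phi> (y + Pp x y *\<^sub>R x) + \<psi> (y + Pp x y *\<^sub>R x)"
    and Pm: "\<And>x y. x \<in> U \<Longrightarrow> Pm x y = \<phi> (y + Pm x y *\<^sub>R x) - \<psi> (y + Pm x y *\<^sub>R x)"
    using rep unfolding implicit_representation_def by blast+
  define pp where "pp p = Pp (fst p) (snd p)" for p
  define pm where "pm p = Pm (fst p) (snd p)" for p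
  have smooth: "smooth_on pp S" "smooth_on pm S"
    using sp sm by (simp_all add: pp_def[abs_def] pm_def[abs_def] case_prod_unfold)
  have \<phi>0: "\<phi> 0 = 0"
    using \<phi>(1)[unfolded pos_homogeneous_def, rule_format, of 2 0] by simp
  have \<psi>0: "\<psi> 0 = 0"
    using \<psi> by (simp add: minkowski_norm_def)
  have d: "\<phi> differentiable (at y)" "\<psi> differentiable (at y)" if "y \<noteq> 0" for y
    using \<psi> smooth_on_differentiable[OF \<phi>(2)] smooth_on_differentiable[of \<psi> "- {0}" y] that
    by (simp_all add: minkowski_norm_def)
  have burgers_pp: "dx u pp p = pp p * dy u pp p" if p: "p \<in> S" for u p
    by (rule implicit_burgers[OF smooth(1), where h = "\<lambda>y. \<phi> y + \<psi> y", OF _ _ _ p])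
      (use d \<phi>0 \<psi>0 Pp in \<open>auto simp: pp_def\<close>)
  have burgers_pm: "dx u pm p = pm p * dy u pm p" if p: "p \<in> S" for u p
    by (rule implicit_burgers[OF smooth(2), where h = "\<lambda>y. \<phi> y - \<psi> y", OF _ _ _ p])
      (use d \<phi>0 \<psi>0 Pm in \<open>auto simp: pm_def\<close>)
  define Q where "Q p = 1/2 * (pp p + pm p)" for p
  have smooth_Q: "smooth_on Q S"
    unfolding Q_def[abs_def] by (intro smooth_intros open_S smooth)
  have f_eq: "f p = 1/2 * (pp p - pm p)" if "p \<in> S" for p
    using F[of "fst p" "snd p"] that by (simp add: f_def pp_def pm_def mem_Times_iff)
  have der_f: "der v f p = 1/2 * (der v pp p - der v pm p)" if p: "p \<in> S" for v p
  proof -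
    have "der v f p = der v (\<lambda>p. 1/2 * (pp p - pm p)) p"
      by (rule der_cong[OF open_S p f_eq])
    also have "\<dots> = 1/2 * der v (\<lambda>p. pp p - pm p) p"
      by (intro der_cmult diff[OF _ p] smooth_intros open_S smooth)
    also have "der v (\<lambda>p. pp p - pm p) p = der v pp p - der v pm p"
      by (intro der_diff diff[OF _ p] smooth)
    finally show ?thesis .
  qed
  have der_Q: "der v Q p = 1/2 * (der v pp p + der v pm p)" if p: "p \<in> S" for v p
  proof -
    have "der v Q p = 1/2 * der v (\<lambda>p. pp p + pm p) p"
      unfolding Q_def[abs_def] by (intro der_cmult diff[OF _ p] smooth_intros open_S smooth)
    also have "der v (\<lambda>p. pp p + pm p) p = der v pp p + der v pm p"
      by (intro der_add diff[OF _ p] smooth)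
    finally show ?thesis .
  qed
  have fx: "dx a f p = Q p * dy a f p + dy a Q p * f p" if p: "p \<in> S" for a p
    unfolding der_f[OF p] der_Q[OF p] f_eq[OF p] Q_def burgers_pp[OF p] burgers_pm[OF p]
    by (simp add: field_simps)
  have Qx: "dx a Q p = Q p * dy a Q p + f p * dy a f p" if p: "p \<in> S" for a p
    unfolding der_f[OF p] der_Q[OF p] f_eq[OF p] Q_def burgers_pp[OF p] burgers_pm[OF p]
    by (simp add: field_simps)
  have Q0: "Q (0, y) = \<phi> y" for y
    using Pp[OF U(2), of y] Pm[OF U(2), of y] by (simp add: Q_def pp_def pm_def)
  have hom: "homogeneous_on U 1 Q"
    by (rule burgers_homogeneous[OF U smooth_Q fx Qx])
      (use \<phi>(1) in \<open>simp_all add: Q0 pos_homogeneous_def\<close>)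
  have QP: "Q p = P p" if p: "p \<in> S" for p
  proof (rule hamel_unique[OF smooth_Q hom _ p])
    show "dx b f q = dy b (\<lambda>p. Q p * f p) q" if q: "q \<in> S" for q b
      unfolding der_mult_f[OF smooth_Q q] by (rule fx[OF q])
  qed
  have der_QP: "der v Q p = der v P p" if p: "p \<in> S" for v p
    by (rule der_cong[OF open_S p QP])
  have hamel
    unfolding hamel_def
  proof (intro ballI allI)
    fix p b assume p: "p \<in> S"
    show "dx b f p = dy b (\<lambda>p. P p * f p) p"
      using fx[OF p, of b] unfolding der_mult_f[OF smooth_P p] der_QP[OF p] QP[OF p] .
  qed
  moreover have riccati
    unfolding riccati_def
  proof (intro ballI allI)
    fix p b assume p: "p \<in> S"
    show "dx b P p = P p * dy b P p + f p * dy b f p"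
      using Qx[OF p, of b] unfolding der_QP[OF p] QP[OF p] .
  qed
  moreover have "\<psi> y = F 0 y" for y
    using Pp[OF U(2), of y] Pm[OF U(2), of y] F[OF U(2), of y] by simp
  moreover have "\<phi> y = proj_factor F 0 y" if "y \<noteq> 0" for y
    using QP[of "(0, y)"] Q0[of y] proj_factor_eq[of 0 y] U(2) that by simp
  ultimately show ?thesis
    by blast
qed

end

theorem theorem1p2:
  fixes F :: "real^'n::finite \<Rightarrow> real^'n \<Rightarrow> real" and U :: "(real^'n) set"
  assumes "2 \<le> CARD('n)"
    and "open U" and "connected U" and "0 \<in> U"
    and "finsler_metric U F"
  shows "(projectively_flat U F \<and> has_flag_curvature U F (- 1) \<longleftrightarrow>
           (\<exists>\<psi> \<phi> Pp Pm. implicit_representation U F \<psi> \<phi> Pp Pm)) \<and>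
         (\<forall>\<psi> \<phi> Pp Pm. implicit_representation U F \<psi> \<phi> Pp Pm \<longrightarrow>
           (\<forall>y. \<psi> y = F 0 y) \<and> (\<forall>y. y \<noteq> 0 \<longrightarrow> \<phi> y = proj_factor F 0 y))"
proof -
  interpret finsler_space U F
    using assms(2,5) by unfold_locales
  note imp = implicit_representation_imp[OF assms(3,4)]
  have "projectively_flat U F \<and> has_flag_curvature U F (- 1) \<longleftrightarrow>
      (\<exists>\<psi> \<phi> Pp Pm. implicit_representation U F \<psi> \<phi> Pp Pm)"
    unfolding projectively_flat_curvature_iff[OF assms(1)]
  proof
    assume "hamel \<and> riccati"
    then have "implicit_representation U F (F 0) (proj_factor F 0)
        (\<lambda>x y. proj_factor F x y + F x y) (\<lambda>x y. proj_factor F x y - F x y)"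
      using implicit_representation_exists[OF assms(1,3,4)] by blast
    then show "\<exists>\<psi> \<phi> Pp Pm. implicit_representation U F \<psi> \<phi> Pp Pm"
      by blast
  next
    assume "\<exists>\<psi> \<phi> Pp Pm. implicit_representation U F \<psi> \<phi> Pp Pm"
    then show "hamel \<and> riccati"
      using imp by blast
  qed
  then show ?thesis
    using imp by blast
qed

end
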